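(* Let $R$ be a commutative ring and let $E$ be a subset of $\operatorname{Spec}(R)$. Then: (i) If $E$ is Zariski closed, then $\mathcal{F}(E)$ is flat closed. (ii) If $E$ is patch closed, then $\mathcal{Z}(E)$ is Zariski closed. (iii) If $E$ is stable under generalization and $E=V(I)$ for some ideal $I$ of $R$, then $R/J$ is a flat $R$-module and $E=V(J)$, where $J$ is the kernel of the canonical map $R\rightarrow S^{-1}R$ with $S=1+I=\{1+x : x\in I\}$.
   Context: All rings are commutative with identity. For a subset (or element, or ideal) $I$ of $R$, $V(I)=\{\mathfrak{p}\in\operatorname{Spec}(R): I\subseteq\mathfrak{p}\}$, and for $f\in R$, $V(f)=\{\mathfrak{p}\in\operatorname{Spec}(R): f\in\mathfrak{p}\}$ and $D(f)=\operatorname{Spec}(R)\setminus V(f)$. For a prime $\mathfrak{p}$, $\Lambda(\mathfrak{p})=\{\mathfrak{q}\in\operatorname{Spec}(R):\mathfrak{q}\subseteq\mathfrak{p}\}$. For $E\subseteq\operatorname{Spec}(R)$, define $\mathcal{F}(E)=\bigcup_{\mathfrak{p}\in E}\Lambda(\mathfrak{p})$ and $\mathcal{Z}(E)=\bigcup_{\mathfrak{p}\in E}V(\mathfrak{p})$. The flat (or inverse) topology on $\operatorname{Spec}(R)$ is the topology for which the sets $V(f)$, $f\in R$, form a sub-basis of open sets. The patch (or constructible) topology on $\operatorname{Spec}(R)$ is the topology for which the sets $D(f)\cap V(g)$, $f,g\in R$, form a sub-basis of open sets. "Flat closed", "patch closed", "Zariski closed" mean closed in the respective topology. A subset $E$ of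 $\operatorname{Spec}(R)$ is stable under generalization if for all primes $\mathfrak{p}\subset\mathfrak{q}$ with $\mathfrak{q}\in E$ one has $\mathfrak{p}\in E$. *)

theory Defs
  imports "HOL-Algebra.QuotRing" "HOL-Algebra.Free_Abelian_Groups" "HOL-Algebra.Generated_Groups"
    "HOL-Algebra.Module" "HOL-Analysis.Abstract_Topology"
begin

definition Spec :: "('a, 'b) ring_scheme \<Rightarrow> 'a set set" where
  "Spec R = {p. primeideal p R}"

definition vanishing :: "('a, 'b) ring_scheme \<Rightarrow> 'a set \<Rightarrow> 'a set set" where
  "vanishing R A = {p \<in> Spec R. A \<subseteq> p}"

definition basic_open :: "('a, 'b) ring_scheme \<Rightarrow> 'a \<Rightarrow> 'a set set" where
  "basic_open R f = Spec R - vanishing R {f}"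

definition generalizations :: "('a, 'b) ring_scheme \<Rightarrow> 'a set \<Rightarrow> 'a set set" where
  "generalizations R p = {q \<in> Spec R. q \<subseteq> p}"

definition generalization_closure :: "('a, 'b) ring_scheme \<Rightarrow> 'a set set \<Rightarrow> 'a set set" where
  "generalization_closure R E = (\<Union>p\<in>E. generalizations R p)"

definition specialization_closure :: "('a, 'b) ring_scheme \<Rightarrow> 'a set set \<Rightarrow> 'a set set" where
  "specialization_closure R E = (\<Union>p\<in>E. vanishing R p)"

definition generalization_stable :: "('a, 'b) ring_scheme \<Rightarrow> 'a set set \<Rightarrow> bool" where
  "generalization_stable R E \<longleftrightarrow> (\<forall>p\<in>Spec R. \<forall>q\<in>Spec R. p \<subset> q \<and> q \<in> E \<longrightarrow> p \<in> E)"

text \<open>For a commutative ring the predicate below satisfies \<^const>\<open>istopology\<close>, so that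
  \<^const>\<open>topology\<close> is applied meaningfully; see \<open>istopology_zariski\<close>.\<close>

definition zariski_topology :: "('a, 'b) ring_scheme \<Rightarrow> 'a set topology" where
  "zariski_topology R = topology (\<lambda>U. \<exists>A \<subseteq> carrier R. U = Spec R - vanishing R A)"

definition flat_topology :: "('a, 'b) ring_scheme \<Rightarrow> 'a set topology" where
  "flat_topology R = topology_generated_by {vanishing R {f} |f. f \<in> carrier R}"

definition patch_topology :: "('a, 'b) ring_scheme \<Rightarrow> 'a set topology" where
  "patch_topology R =
     topology_generated_by {basic_open R f \<inter> vanishing R {g} |f g. f \<in> carrier R \<and> g \<in> carrier R}"

lemma vanishing_mult:
  assumes "A \<subseteq> carrier R" "B \<subseteq> carrier R"
  shows "vanishing R {a \<otimes>\<^bsub>R\<^esub> b |a b. a \<in> A \<and> b \<in> B} = vanishing R A \<union> vanishing R B"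
proof
  show "vanishing R {a \<otimes>\<^bsub>R\<^esub> b |a b. a \<in> A \<and> b \<in> B} \<subseteq> vanishing R A \<union> vanishing R B"
  proof
    fix p assume p: "p \<in> vanishing R {a \<otimes>\<^bsub>R\<^esub> b |a b. a \<in> A \<and> b \<in> B}"
    then interpret primeideal p R by (simp add: vanishing_def Spec_def)
    have "A \<subseteq> p \<or> B \<subseteq> p"
    proof (rule ccontr)
      assume "\<not> ?thesis"
      then obtain a b where ab: "a \<in> A" "a \<notin> p" "b \<in> B" "b \<notin> p" by blast
      then have "a \<otimes>\<^bsub>R\<^esub> b \<in> p" using p by (auto simp: vanishing_def)
      then show False using I_prime ab assms by blast
    qed
    then show "p \<in> vanishing R A \<union> vanishing R B" using p by (auto simp: vanishing_def)
  qed
  show "vanishing R A \<union> vanishing R B \<subseteq> vanishing R {a \<otimes>\<^bsub>R\<^esub> b |a b. a \<in> A \<and> b \<in> B}"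
  proof
    fix p assume p: "p \<in> vanishing R A \<union> vanishing R B"
    then interpret primeideal p R by (auto simp: vanishing_def Spec_def)
    show "p \<in> vanishing R {a \<otimes>\<^bsub>R\<^esub> b |a b. a \<in> A \<and> b \<in> B}"
      using p assms by (auto simp: vanishing_def intro: I_l_closed I_r_closed)
  qed
qed

lemma istopology_zariski:
  assumes "cring R"
  shows "istopology (\<lambda>U. \<exists>A \<subseteq> carrier R. U = Spec R - vanishing R A)"
  unfolding istopology_def
proof (intro conjI allI impI)
  interpret cring R by fact
  fix U W
  assume "\<exists>A \<subseteq> carrier R. U = Spec R - vanishing R A"
    and "\<exists>A \<subseteq> carrier R. W = Spec R - vanishing R A"
  then obtain A B where AB: "A \<subseteq> carrier R" "B \<subseteq> carrier R"
    "U = Spec R - vanishing R A" "W = Spec R - vanishing R B" by blast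
  let ?C = "{a \<otimes>\<^bsub>R\<^esub> b |a b. a \<in> A \<and> b \<in> B}"
  have "?C \<subseteq> carrier R" using AB by auto
  moreover have "U \<inter> W = Spec R - vanishing R ?C"
    using AB by (auto simp: vanishing_mult)
  ultimately show "\<exists>A \<subseteq> carrier R. U \<inter> W = Spec R - vanishing R A" by blast
next
  fix K assume "\<forall>U\<in>K. \<exists>A \<subseteq> carrier R. U = Spec R - vanishing R A"
  then obtain A where A: "\<And>U. U \<in> K \<Longrightarrow> A U \<subseteq> carrier R \<and> U = Spec R - vanishing R (A U)"
    by metis
  have "\<Union>K = Spec R - vanishing R (\<Union>U\<in>K. A U)"
  proof (intro equalityI subsetI)
    fix p assume "p \<in> \<Union>K"
    then obtain U where "U \<in> K" "p \<in> Spec R - vanishing R (A U)" using A by blast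
    then show "p \<in> Spec R - vanishing R (\<Union>U\<in>K. A U)" by (auto simp: vanishing_def)
  next
    fix p assume "p \<in> Spec R - vanishing R (\<Union>U\<in>K. A U)"
    then obtain U where "U \<in> K" "p \<in> Spec R - vanishing R (A U)" by (auto simp: vanishing_def)
    then show "p \<in> \<Union>K" using A by blast
  qed
  then show "\<exists>A \<subseteq> carrier R. \<Union>K = Spec R - vanishing R A"
    using A by (intro exI[of _ "\<Union>U\<in>K. A U"]) blast
qed

lemma closedin_zariski_iff:
  assumes "cring R"
  shows "closedin (zariski_topology R) E \<longleftrightarrow> (\<exists>A \<subseteq> carrier R. E = vanishing R A)"
proof -
  have op: "openin (zariski_topology R) U \<longleftrightarrow> (\<exists>A \<subseteq> carrier R. U = Spec R - vanishing R A)" for U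
    by (simp add: zariski_topology_def istopology_zariski[OF assms])
  interpret cring R by fact
  have V: "vanishing R A \<subseteq> Spec R" for A by (auto simp: vanishing_def)
  have "vanishing R {\<one>\<^bsub>R\<^esub>} = {}"
    by (auto simp: vanishing_def Spec_def dest: ideal.one_imp_carrier[OF primeideal.axioms(1)]
        primeideal.I_notcarr)
  then have "openin (zariski_topology R) (Spec R)"
    unfolding op by (intro exI[of _ "{\<one>\<^bsub>R\<^esub>}"]) simp
  moreover have "openin (zariski_topology R) U \<Longrightarrow> U \<subseteq> Spec R" for U unfolding op by blast
  ultimately have top: "topspace (zariski_topology R) = Spec R"
    by (metis openin_subset openin_topspace subset_antisym)
  show ?thesis unfolding closedin_def top op using V by (metis double_diff order_refl)
qed

text \<open>For \<open>s \<in> S\<close>, \<open>fraction R S r s\<close> is the class of \<open>(r, s)\<close> in \<open>R \<times> S\<close> modulo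
  \<open>(r, s) \<sim> (r', s') \<longleftrightarrow> (\<exists>t\<in>S. t r s' = t r' s)\<close>. In the operations of \<open>localization\<close>,
  all members of the union coincide when \<open>S\<close> is multiplicative.\<close>

definition fraction :: "('a, 'b) ring_scheme \<Rightarrow> 'a set \<Rightarrow> 'a \<Rightarrow> 'a \<Rightarrow> ('a \<times> 'a) set" where
  "fraction R S r s = {(r', s') \<in> carrier R \<times> S.
     \<exists>t\<in>S. t \<otimes>\<^bsub>R\<^esub> (r \<otimes>\<^bsub>R\<^esub> s') = t \<otimes>\<^bsub>R\<^esub> (r' \<otimes>\<^bsub>R\<^esub> s)}"

definition localization :: "('a, 'b) ring_scheme \<Rightarrow> 'a set \<Rightarrow> ('a \<times> 'a) set ring" where
  "localization R S =
     \<lparr>carrier = {fraction R S r s |r s. r \<in> carrier R \<and> s \<in> S},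
      monoid.mult = (\<lambda>X Y. \<Union>{fraction R S (a \<otimes>\<^bsub>R\<^esub> b) (s \<otimes>\<^bsub>R\<^esub> t) |a s b t. (a, s) \<in> X \<and> (b, t) \<in> Y}),
      monoid.one = fraction R S \<one>\<^bsub>R\<^esub> \<one>\<^bsub>R\<^esub>,
      ring.zero = fraction R S \<zero>\<^bsub>R\<^esub> \<one>\<^bsub>R\<^esub>,
      ring.add = (\<lambda>X Y. \<Union>{fraction R S (a \<otimes>\<^bsub>R\<^esub> t \<oplus>\<^bsub>R\<^esub> b \<otimes>\<^bsub>R\<^esub> s) (s \<otimes>\<^bsub>R\<^esub> t) |a s b t.
               (a, s) \<in> X \<and> (b, t) \<in> Y})\<rparr>"

definition localization_map :: "('a, 'b) ring_scheme \<Rightarrow> 'a set \<Rightarrow> 'a \<Rightarrow> ('a \<times> 'a) set" where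
  "localization_map R S r = fraction R S r \<one>\<^bsub>R\<^esub>"

definition module_hom ::
  "('r, 'e) ring_scheme \<Rightarrow> ('r, 'm) module \<Rightarrow> ('r, 'n) module \<Rightarrow> ('m \<Rightarrow> 'n) set" where
  "module_hom R M N = {f \<in> hom (add_monoid M) (add_monoid N).
     \<forall>r\<in>carrier R. \<forall>x\<in>carrier M. f (r \<odot>\<^bsub>M\<^esub> x) = r \<odot>\<^bsub>N\<^esub> f x}"

definition tensor_relations ::
  "('r, 'e) ring_scheme \<Rightarrow> ('r, 'm) module \<Rightarrow> ('r, 'n) module \<Rightarrow> ('m \<times> 'n \<Rightarrow>\<^sub>0 int) set" where
  "tensor_relations R M N =
     {frag_of (x \<oplus>\<^bsub>M\<^esub> x', y) - frag_of (x, y) - frag_of (x', y) |x x' y.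
        x \<in> carrier M \<and> x' \<in> carrier M \<and> y \<in> carrier N} \<union>
     {frag_of (x, y \<oplus>\<^bsub>N\<^esub> y') - frag_of (x, y) - frag_of (x, y') |x y y'.
        x \<in> carrier M \<and> y \<in> carrier N \<and> y' \<in> carrier N} \<union>
     {frag_of (r \<odot>\<^bsub>M\<^esub> x, y) - frag_of (x, r \<odot>\<^bsub>N\<^esub> y) |r x y.
        r \<in> carrier R \<and> x \<in> carrier M \<and> y \<in> carrier N}"

definition tensor_kernel ::
  "('r, 'e) ring_scheme \<Rightarrow> ('r, 'm) module \<Rightarrow> ('r, 'n) module \<Rightarrow> ('m \<times> 'n \<Rightarrow>\<^sub>0 int) set" where
  "tensor_kernel R M N =
     generate (free_Abelian_group (carrier M \<times> carrier N)) (tensor_relations R M N)"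

text \<open>The abelian group underlying \<open>M \<otimes>\<^sub>R N\<close>. The scalar action is not recorded, as exactness
  of a sequence of modules depends on the underlying groups only.\<close>

definition tensor_product ::
  "('r, 'e) ring_scheme \<Rightarrow> ('r, 'm) module \<Rightarrow> ('r, 'n) module \<Rightarrow> ('m \<times> 'n \<Rightarrow>\<^sub>0 int) set monoid"
  where
  "tensor_product R M N =
     free_Abelian_group (carrier M \<times> carrier N) Mod tensor_kernel R M N"

text \<open>The homomorphism \<open>M \<otimes>\<^sub>R N \<rightarrow> M \<otimes>\<^sub>R N'\<close> induced by a linear map \<open>f : N \<rightarrow> N'\<close>: it takes the
  coset of \<open>c\<close> to the coset of the image of \<open>c\<close> under the additive extension of
  \<open>(x, y) \<mapsto> (x, f y)\<close>.\<close>

definition tensor_map ::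
  "('r, 'e) ring_scheme \<Rightarrow> ('r, 'm) module \<Rightarrow> ('r, 'n) module \<Rightarrow> ('r, 'k) module \<Rightarrow> ('n \<Rightarrow> 'k)
     \<Rightarrow> ('m \<times> 'n \<Rightarrow>\<^sub>0 int) set \<Rightarrow> ('m \<times> 'k \<Rightarrow>\<^sub>0 int) set" where
  "tensor_map R M N N' f X =
     (\<Union>c\<in>X. tensor_kernel R M N' #>\<^bsub>free_Abelian_group (carrier M \<times> carrier N')\<^esub>
              frag_extend (\<lambda>(x, y). frag_of (x, f y)) c)"

text \<open>\<open>M\<close> is flat if \<open>M \<otimes>\<^sub>R _\<close> carries exact sequences \<open>N1 \<rightarrow> N2 \<rightarrow> N3\<close> to exact sequences.
  A definition cannot quantify over types, so the types carrying \<open>N1\<close>, \<open>N2\<close>, \<open>N3\<close> are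
  parameters; a theorem concluding flatness with these left as type variables asserts it
  for modules over arbitrary types.\<close>

definition flat_module ::
  "'x itself \<Rightarrow> 'y itself \<Rightarrow> 'z itself \<Rightarrow> ('r, 'e) ring_scheme \<Rightarrow> ('r, 'm) module \<Rightarrow> bool" where
  "flat_module _ _ _ R M \<longleftrightarrow> Module.module R M \<and>
     (\<forall>(N1 :: ('r, 'x) module) (N2 :: ('r, 'y) module) (N3 :: ('r, 'z) module) f g.
        Module.module R N1 \<and> Module.module R N2 \<and> Module.module R N3 \<and>
        f \<in> module_hom R N1 N2 \<and> g \<in> module_hom R N2 N3 \<and>
        f ` carrier N1 = a_kernel N2 N3 g \<longrightarrow>
        tensor_map R M N1 N2 f ` carrier (tensor_product R M N1) =
          kernel (tensor_product R M N2) (tensor_product R M N3) (tensor_map R M N2 N3 g))"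

definition quotient_module :: "('a, 'b) ring_scheme \<Rightarrow> 'a set \<Rightarrow> ('a, 'a set) module" where
  "quotient_module R J =
     ring.extend (R Quot J)
       (Module.module.fields (\<lambda>r X. (J +>\<^bsub>R\<^esub> r) \<otimes>\<^bsub>R Quot J\<^esub> X))"

end

(* (i) If no prime contains both a prime q and an ideal I, then x + y = 1 with x in q and y in I, and
   V(x) is a flat neighbourhood of q that misses the generalizations of the points of V(I).
   (ii) Spec(R) is patch compact by Alexander's subbase theorem: given a cover by sets D(f) and V(f),
   the f with D(f) finitely covered form an ideal, the f with V(f) finitely covered form a
   multiplicative set, and a prime containing the former and disjoint from the latter would lie in no
   member of the cover. If p contains the intersection of a patch closed E but no member of E, then
   the sets V(f) with f not in p cover E, and the product of finitely many such f lies in that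
   intersection although not in p.
   (iii) Prime avoidance gives V(J) = V(I), and a in J satisfies a = (-x)^n a for some x in I. As a
   power of -x lies in J, the ideal J is pure: a = b a with b in J. For pure J the group R/J (x) N is
   N/JN, and JN consists of the n with n = b n for some b in J; exactness is then checked directly. *)
theory Submission
  imports Defs "HOL-Algebra.Ring_Divisibility" "HOL-Analysis.Function_Topology"
begin

section \<open>Flat and patch closed sets of primes\<close>

lemma Spec_primeideal: "p \<in> Spec R \<Longrightarrow> primeideal p R"
  by (simp add: Spec_def)

lemma Spec_ideal: "p \<in> Spec R \<Longrightarrow> ideal p R"
  by (simp add: Spec_primeideal primeideal.axioms(1))

lemma Spec_additive_subgroup: "p \<in> Spec R \<Longrightarrow> additive_subgroup p R"
  by (simp add: Spec_ideal ideal.axioms(1))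

lemma Spec_zero: "p \<in> Spec R \<Longrightarrow> \<zero>\<^bsub>R\<^esub> \<in> p"
  by (rule additive_subgroup.zero_closed[OF Spec_additive_subgroup])

lemma (in cring) one_notin_Spec:
  assumes "p \<in> Spec R"
  shows "\<one> \<notin> p"
  using ideal.one_imp_carrier[OF Spec_ideal] primeideal.I_notcarr[OF Spec_primeideal] assms by metis

text \<open>By Zorn there is an ideal \<open>M\<close> maximal among those containing
  \<open>I\<close> and disjoint from \<open>S\<close>. It is prime: two elements outside
  \<open>M\<close> would each generate together with \<open>M\<close> an ideal meeting
  \<open>S\<close>, and the product of the two elements met would lie in \<open>S\<close> and, if
  \<open>a b\<close> is in \<open>M\<close>, also in \<open>M\<close>.\<close>

lemma (in cring) exists_prime_disjoint:
  assumes I: "ideal I R" and S: "S \<subseteq> carrier R" "\<one> \<in> S"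
    and mult: "\<And>a b. \<lbrakk>a \<in> S; b \<in> S\<rbrakk> \<Longrightarrow> a \<otimes> b \<in> S"
    and disj: "I \<inter> S = {}"
  obtains p where "p \<in> Spec R" "I \<subseteq> p" "p \<inter> S = {}"
proof -
  let ?A = "{J. ideal J R \<and> I \<subseteq> J \<and> J \<inter> S = {}}"
  have "\<exists>M\<in>?A. \<forall>X\<in>?A. M \<subseteq> X \<longrightarrow> X = M"
  proof (rule subset_Zorn_nonempty)
    show "?A \<noteq> {}" using I disj by blast
    fix C assume C: "C \<noteq> {}" "subset.chain ?A C"
    then have "subset.chain {I. ideal I R} C" by (auto simp: pred_on.chain_def)
    then have "ideal (\<Union>C) R" using chain_Union_is_ideal[of C] C(1) by auto
    moreover have "I \<subseteq> \<Union>C" "\<Union>C \<inter> S = {}"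
      using C unfolding pred_on.chain_def by blast+
    ultimately show "\<Union>C \<in> ?A" by blast
  qed
  then obtain M where M: "ideal M R" "I \<subseteq> M" "M \<inter> S = {}"
    and max: "\<And>X. \<lbrakk>ideal X R; M \<subseteq> X; X \<inter> S = {}\<rbrakk> \<Longrightarrow> X = M"
    by (metis (mono_tags, lifting) mem_Collect_eq subset_trans)
  interpret M: ideal M R by fact
  \<comment> \<open>\<open>M + (a)\<close> is strictly larger than \<open>M\<close>, so by
    maximality it meets \<open>S\<close>; its elements have the form \<open>m + r a\<close>.\<close>
  have meet: "\<exists>m\<in>M. \<exists>r\<in>carrier R. m \<oplus> r \<otimes> a \<in> S" if a: "a \<in> carrier R" "a \<notin> M" for a
  proof -
    have id: "ideal (M <+> PIdl a) R" using add_ideals M(1) cgenideal_ideal a(1) by blast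
    have sub: "M \<subseteq> M <+> PIdl a"
    proof
      fix m assume "m \<in> M"
      moreover have "\<zero> \<in> PIdl a"
        using additive_subgroup.zero_closed ideal.axioms(1) cgenideal_ideal a(1) by blast
      ultimately show "m \<in> M <+> PIdl a"
        unfolding set_add_def' using M.Icarr r_zero by force
    qed
    have "a \<in> M <+> PIdl a"
      unfolding set_add_def' using M.zero_closed cgenideal_self[OF a(1)] l_zero[OF a(1), symmetric]
      by blast
    then have "(M <+> PIdl a) \<inter> S \<noteq> {}" using max[OF id sub] a(2) by blast
    then obtain x :: 'a where "x \<in> M <+> PIdl a" "x \<in> S" by blast
    then show ?thesis unfolding set_add_def' cgenideal_def by blast
  qed
  have "primeideal M R"
  proof (rule primeidealI[OF M(1) is_cring])
    show "carrier R \<noteq> M" using M(3) S by blast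
    fix a b assume ab: "a \<in> carrier R" "b \<in> carrier R" "a \<otimes> b \<in> M"
    show "a \<in> M \<or> b \<in> M"
    proof (rule ccontr)
      assume "\<not> (a \<in> M \<or> b \<in> M)"
      then obtain m r n s where *: "m \<in> M" "r \<in> carrier R" "m \<oplus> r \<otimes> a \<in> S"
        "n \<in> M" "s \<in> carrier R" "n \<oplus> s \<otimes> b \<in> S" using meet ab by metis
      have c: "m \<in> carrier R" "n \<in> carrier R" using * M.Icarr by auto
      \<comment> \<open>After expansion every summand has a factor \<open>m\<close>,
        \<open>n\<close> or \<open>a b\<close>, all in \<open>M\<close>.\<close>
      have "(m \<oplus> r \<otimes> a) \<otimes> (n \<oplus> s \<otimes> b)
          = m \<otimes> (n \<oplus> s \<otimes> b) \<oplus> (n \<otimes> (r \<otimes> a) \<oplus> (r \<otimes> s) \<otimes> (a \<otimes> b))"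
        using c * ab by algebra
      also have "\<dots> \<in> M"
        using c * ab 
        by (intro M.a_closed M.I_r_closed[of m] M.I_r_closed[of n] M.I_l_closed[of "a \<otimes> b"]) auto
      finally show False using mult * M(3) by blast
    qed
  qed
  then show thesis using that M by (simp add: Spec_def)
qed

lemma (in cring) exists_prime_above:
  assumes I: "ideal I R" and "\<one> \<notin> I"
  obtains p where "p \<in> Spec R" "I \<subseteq> p"
  using exists_prime_disjoint[OF I, of "{\<one>}"] assms(2) by auto

lemma (in cring) vanishing_genideal:
  assumes "A \<subseteq> carrier R"
  shows "vanishing R (Idl A) = vanishing R A"
  using Idl_subset_ideal[OF _ assms] primeideal.axioms(1)
  unfolding vanishing_def Spec_def by blast

lemma (in cring) closedin_zariski_ideal:
  assumes "closedin (zariski_topology R) E"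
  obtains I where "ideal I R" "E = vanishing R I"
  using assms genideal_ideal vanishing_genideal closedin_zariski_iff[OF is_cring] by metis

text \<open>The last assumption says that 1 is not in \<open>I + J\<close>; any prime above this sum
  will do.\<close>

lemma (in cring) exists_prime_above_both:
  assumes I: "ideal I R" and J: "ideal J R"
    and "\<And>x y. \<lbrakk>x \<in> I; y \<in> J\<rbrakk> \<Longrightarrow> x \<oplus> y \<noteq> \<one>"
  obtains p where "p \<in> Spec R" "I \<subseteq> p" "J \<subseteq> p"
proof -
  have "\<one> \<notin> I <+> J" using assms(3) by (force simp: set_add_def')
  moreover have "I \<union> J \<subseteq> I <+> J"
    using union_genideal[OF I J] genideal_self[of "I \<union> J"] I J
    by (metis Un_subset_iff additive_subgroup.a_subset ideal.axioms(1))
  ultimately show thesis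
    using exists_prime_above[OF add_ideals[OF I J]] that by (metis Un_subset_iff subset_trans)
qed

section \<open>Generalizations of a Zariski closed set\<close>

lemma (in cring) closedin_flat_generalization_closure:
  assumes "closedin (zariski_topology R) E"
  shows "closedin (flat_topology R) (generalization_closure R E)"
proof -
  obtain I where I: "ideal I R" and E: "E = vanishing R I"
    using closedin_zariski_ideal assms by blast
  let ?B = "{vanishing R {f} |f. f \<in> carrier R}"
  \<comment> \<open>As V(0) is a sub-basic set, the union of the sub-basis, which is the space of
    the generated topology, is all of Spec(R).\<close>
  have "vanishing R {\<zero>} = Spec R"
    by (auto simp: vanishing_def Spec_zero)
  then have "Spec R \<in> ?B" by (metis (mono_tags, lifting) mem_Collect_eq zero_closed)
  moreover have "vanishing R A \<subseteq> Spec R" for A by (auto simp: vanishing_def)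
  ultimately have top: "topspace (flat_topology R) = Spec R"
    unfolding flat_topology_def topology_generated_by_topspace by blast
  have "\<exists>T. openin (flat_topology R) T \<and> q \<in> T \<and> T \<subseteq> Spec R - generalization_closure R E"
    if q: "q \<in> Spec R - generalization_closure R E" for q
  proof -
    have qi: "ideal q R" using q primeideal.axioms(1) by (auto simp: Spec_def)
    have "\<exists>x\<in>q. \<exists>y\<in>I. x \<oplus> y = \<one>"
    proof (rule ccontr)
      assume "\<not> ?thesis"
      then obtain p where "p \<in> Spec R" "q \<subseteq> p" "I \<subseteq> p"
        using exists_prime_above_both[OF qi I] by blast
      then show False
        using q E by (auto simp: generalization_closure_def generalizations_def vanishing_def)
    qed
    then obtain x y where xy: "x \<in> q" "y \<in> I" "x \<oplus> y = \<one>" by blast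
    have x: "x \<in> carrier R" using xy qi ideal.Icarr by fastforce
    \<comment> \<open>A common point lies below some \<open>p\<close> in V(I), which then contains
      \<open>x\<close> as well as \<open>y\<close>, hence 1.\<close>
    have "vanishing R {x} \<inter> generalization_closure R E = {}"
    proof (rule ccontr)
      assume "\<not> ?thesis"
      then obtain p where p: "p \<in> Spec R" "I \<subseteq> p" "x \<in> p"
        using E by (auto simp: generalization_closure_def generalizations_def vanishing_def)
      then have "x \<oplus> y \<in> p"
        using xy additive_subgroup.a_closed ideal.axioms(1) primeideal.axioms(1) Spec_primeideal
        by (metis subsetD)
      then show False using xy p one_notin_Spec by simp
    qed
    moreover have "openin (flat_topology R) (vanishing R {x})"
      unfolding flat_topology_def using x by (intro topology_generated_by_Basis) blast
    moreover have "q \<in> vanishing R {x}" using q xy by (auto simp: vanishing_def)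
    ultimately show ?thesis by (auto simp: vanishing_def)
  qed
  then have "openin (flat_topology R) (Spec R - generalization_closure R E)"
    by (subst openin_subopen) blast
  moreover have "generalization_closure R E \<subseteq> Spec R"
    by (auto simp: generalization_closure_def generalizations_def)
  ultimately show ?thesis by (simp add: closedin_def top)
qed

section \<open>Compactness of the patch topology\<close>

lemma (in cring) topspace_patch: "topspace (patch_topology R) = Spec R"
proof -
  have "vanishing R {\<zero>} = Spec R"
    by (auto simp: vanishing_def Spec_zero)
  moreover have "basic_open R \<one> = Spec R"
    using one_notin_Spec by (auto simp: basic_open_def vanishing_def)
  ultimately have "Spec R = basic_open R \<one> \<inter> vanishing R {\<zero>}" by simp
  then have "Spec R \<subseteq> \<Union> {basic_open R f \<inter> vanishing R {g} |f g. f \<in> carrier R \<and> g \<in> carrier R}"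
    by blast
  moreover have "\<Union> {basic_open R f \<inter> vanishing R {g} |f g. f \<in> carrier R \<and> g \<in> carrier R} \<subseteq> Spec R"
    by (auto simp: vanishing_def)
  ultimately show ?thesis
    unfolding patch_topology_def topology_generated_by_topspace by blast
qed

lemma (in cring) openin_patch_vanishing:
  assumes "f \<in> carrier R"
  shows "openin (patch_topology R) (vanishing R {f})"
proof -
  have "vanishing R {f} = basic_open R \<one> \<inter> vanishing R {f}"
    using one_notin_Spec by (auto simp: basic_open_def vanishing_def)
  then show ?thesis unfolding patch_topology_def using assms
    by (intro topology_generated_by_Basis) blast
qed

lemma basic_open_iff: "p \<in> basic_open R f \<longleftrightarrow> p \<in> Spec R \<and> f \<notin> p"
  by (auto simp: basic_open_def vanishing_def)

lemma vanishing_singleton_iff: "p \<in> vanishing R {f} \<longleftrightarrow> p \<in> Spec R \<and> f \<in> p"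
  by (auto simp: vanishing_def)

lemma (in cring) Spec_subbasic_cover:
  assumes C: "C \<subseteq> basic_open R ` carrier R \<union> (\<lambda>f. vanishing R {f}) ` carrier R"
    and cov: "Spec R \<subseteq> \<Union>C"
  shows "\<exists>C'. finite C' \<and> C' \<subseteq> C \<and> Spec R \<subseteq> \<Union>C'"
proof -
  \<comment> \<open>\<open>fc X\<close> says that finitely many members of \<open>C\<close> cover
    \<open>X\<close>. It passes to subsets and to finite unions.\<close>
  define fc where "fc X \<longleftrightarrow> (\<exists>C'. finite C' \<and> C' \<subseteq> C \<and> X \<subseteq> \<Union>C')" for X
  have fc_mono: "fc Y \<Longrightarrow> X \<subseteq> Y \<Longrightarrow> fc X" for X Y unfolding fc_def by blast
  have fc_Un: "fc (X \<union> Y)" if XY: "fc X" "fc Y" for X Y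
  proof -
    obtain C1 C2 where "finite C1" "C1 \<subseteq> C" "X \<subseteq> \<Union>C1" "finite C2" "C2 \<subseteq> C" "Y \<subseteq> \<Union>C2"
      using XY unfolding fc_def by blast
    then show ?thesis unfolding fc_def by (intro exI[of _ "C1 \<union> C2"]) blast
  qed
  have fc_mem: "fc X" if "X \<in> C" for X
    unfolding fc_def using that by (intro exI[of _ "{X}"]) auto
  \<comment> \<open>Since D(f) and V(f) together cover Spec(R), an \<open>f\<close> common to
    \<open>?I\<close> and \<open>?S\<close> suffices. \<open>?I\<close> is an ideal because D(a + b)
    lies in the union of D(a) and D(b); \<open>?S\<close> is multiplicative because V(ab) lies in
    the union of V(a) and V(b).\<close>
  let ?I = "{x \<in> carrier R. fc (basic_open R x)}" and ?S = "{s \<in> carrier R. fc (vanishing R {s})}"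
  have add: "a \<oplus> b \<in> p" if "p \<in> Spec R" "a \<in> p" "b \<in> p" for a b p
    by (rule additive_subgroup.a_closed[OF Spec_additive_subgroup[OF that(1)] that(2,3)])
  have mul: "a \<otimes> b \<in> p" "b \<otimes> a \<in> p" if "p \<in> Spec R" "a \<in> p" "b \<in> carrier R" for a b p
    by (rule ideal.I_r_closed[OF Spec_ideal[OF that(1)] that(2,3)],
        rule ideal.I_l_closed[OF Spec_ideal[OF that(1)] that(2,3)])
  have I: "ideal ?I R"
  proof (rule idealI[OF ring_axioms])
    show "subgroup ?I (add_monoid R)"
    proof (rule add.subgroupI)
      have "basic_open R \<zero> = {}"
        by (auto simp: basic_open_iff Spec_zero)
      then have "\<zero> \<in> ?I" unfolding fc_def by auto
      then show "?I \<noteq> {}" by blast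
      show "\<ominus> a \<in> ?I" if "a \<in> ?I" for a
      proof -
        have "basic_open R (\<ominus> a) \<subseteq> basic_open R a"
          using that additive_subgroup.a_inv_closed[OF Spec_additive_subgroup]
          by (fastforce simp: basic_open_iff)
        then show ?thesis using that fc_mono by blast
      qed
      show "a \<oplus> b \<in> ?I" if "a \<in> ?I" "b \<in> ?I" for a b
      proof -
        have "basic_open R (a \<oplus> b) \<subseteq> basic_open R a \<union> basic_open R b"
          using add by (auto simp: basic_open_iff)
        then show ?thesis using that fc_Un fc_mono by blast
      qed
    qed auto
    fix a x assume ax: "a \<in> ?I" "x \<in> carrier R"
    have "basic_open R (x \<otimes> a) \<subseteq> basic_open R a" "basic_open R (a \<otimes> x) \<subseteq> basic_open R a"
      using mul ax by (auto simp: basic_open_iff)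
    then show "x \<otimes> a \<in> ?I" "a \<otimes> x \<in> ?I" using ax fc_mono by blast+
  qed
  have one: "\<one> \<in> ?S"
  proof -
    have "vanishing R {\<one>} = {}" using one_notin_Spec by (auto simp: vanishing_singleton_iff)
    then show ?thesis unfolding fc_def by (auto intro: exI[of _ "{}"])
  qed
  have times: "a \<otimes> b \<in> ?S" if "a \<in> ?S" "b \<in> ?S" for a b
  proof -
    have "vanishing R {a \<otimes> b} \<subseteq> vanishing R {a} \<union> vanishing R {b}"
      using that primeideal.I_prime[OF Spec_primeideal] by (fastforce simp: vanishing_singleton_iff)
    then show ?thesis using that fc_Un fc_mono by blast
  qed
  \<comment> \<open>Some member of the cover contains \<open>q\<close>. If it is D(f), then
    \<open>f\<close> is in \<open>?I\<close> and so in \<open>q\<close>; if it is V(f), then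
    \<open>f\<close> is in both \<open>?S\<close> and \<open>q\<close>. Either way there is a
    contradiction.\<close>
  have no_prime: False if q: "q \<in> Spec R" "?I \<subseteq> q" "q \<inter> ?S = {}" for q
  proof -
    obtain X where X: "X \<in> C" "q \<in> X" using cov q by blast
    then consider f where "f \<in> carrier R" "X = basic_open R f"
      | f where "f \<in> carrier R" "X = vanishing R {f}"
      using C by blast
    then show False
      using fc_mem[OF X(1)] X(2) q by cases (auto simp: basic_open_iff vanishing_singleton_iff)
  qed
  have "?I \<inter> ?S \<noteq> {}"
  proof
    assume disj: "?I \<inter> ?S = {}"
    have "?S \<subseteq> carrier R" by blast
    then obtain q where "q \<in> Spec R" "?I \<subseteq> q" "q \<inter> ?S = {}"
      by (rule exists_prime_disjoint[OF I _ one times disj])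
    then show False by (rule no_prime)
  qed
  then obtain f where f: "f \<in> ?I" "f \<in> ?S" by blast
  have "Spec R \<subseteq> basic_open R f \<union> vanishing R {f}"
    by (auto simp: basic_open_iff vanishing_singleton_iff)
  then have "fc (Spec R)" using fc_Un f fc_mono by blast
  then show ?thesis unfolding fc_def .
qed

text \<open>Alexander's theorem is applied to the topology \<open>X\<close> with the single sets
  D(f) and V(g) as sub-basis, so that covers by intersections need not be considered. Every patch
  open set is open in \<open>X\<close> and the underlying sets agree, so compactness carries
  over.\<close>

lemma (in cring) compact_space_patch: "compact_space (patch_topology R)"
proof -
  let ?B = "basic_open R ` carrier R \<union> (\<lambda>f. vanishing R {f}) ` carrier R"
  define X where
    "X = topology (arbitrary union_of (finite intersection_of (\<lambda>x. x \<in> ?B) relative_to Spec R))"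
  have top: "topspace X = Spec R" by (simp add: X_def)
  have inB: "openin X V" if "V \<in> ?B" for V
  proof -
    \<comment> \<open>The sub-basis of \<open>X\<close> is taken relative to Spec(R), which does not
      change sets that are already contained in it.\<close>
    have "V = Spec R \<inter> V" using that by (auto simp: basic_open_iff vanishing_singleton_iff)
    moreover have "openin X (Spec R \<inter> V)"
      unfolding X_def openin_subbase using that
      by (intro arbitrary_union_of_inc relative_to_inc finite_intersection_of_inc)
    ultimately show ?thesis by simp
  qed
  have "\<one> \<in> carrier R" "Spec R = basic_open R \<one>"
    using one_notin_Spec by (auto simp: basic_open_iff)
  then have "Spec R \<subseteq> \<Union>?B" by blast
  then have comp: "compact_space X"
    by (rule Alexander_subbase_alt[OF _ Spec_subbasic_cover X_def[symmetric]])
  have finer: "openin X U" if "openin (patch_topology R) U" for U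
  proof -
    have "generate_topology_on
        {basic_open R f \<inter> vanishing R {g} |f g. f \<in> carrier R \<and> g \<in> carrier R} U"
      using that unfolding patch_topology_def openin_topology_generated_by_iff .
    then show ?thesis
    proof induction
      case (Basis s)
      then obtain f g where "f \<in> carrier R" "g \<in> carrier R" "s = basic_open R f \<inter> vanishing R {g}"
        by blast
      then show ?case using inB[of "basic_open R f"] inB[of "vanishing R {g}"] openin_Int by blast
    qed auto
  qed
  show ?thesis
    using comp finer unfolding compact_space_alt top topspace_patch by metis
qed

section \<open>Specializations of a patch closed set\<close>

lemma (in cring) specialization_closure_eq_vanishing_Inter:
  assumes E: "closedin (patch_topology R) E" "E \<noteq> {}"
  shows "specialization_closure R E = vanishing R (\<Inter>E)"
proof
  show "specialization_closure R E \<subseteq> vanishing R (\<Inter>E)"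
    by (auto simp: specialization_closure_def vanishing_def)
  show "vanishing R (\<Inter>E) \<subseteq> specialization_closure R E"
  proof (rule subsetI, rule ccontr)
    fix p assume p: "p \<in> vanishing R (\<Inter>E)" and "p \<notin> specialization_closure R E"
    then have no: "\<not> q \<subseteq> p" if "q \<in> E" for q
      using that by (auto simp: specialization_closure_def vanishing_def)
    have pS: "p \<in> Spec R" using p by (simp add: vanishing_def)
    have ES: "E \<subseteq> Spec R" using closedin_subset[OF E(1)] topspace_patch by simp
    let ?C = "(\<lambda>f. vanishing R {f}) ` (carrier R - p)"
    \<comment> \<open>No \<open>q\<close> in \<open>E\<close> lies inside \<open>p\<close>, so each
      contains some \<open>f\<close> outside \<open>p\<close> and belongs to V(f).\<close>
    have cov: "E \<subseteq> \<Union>?C"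
    proof
      fix q assume q: "q \<in> E"
      then obtain f where "f \<in> q" "f \<notin> p" using no by blast
      moreover have "f \<in> carrier R"
        using ideal.Icarr[OF Spec_ideal \<open>f \<in> q\<close>] q ES by blast
      ultimately show "q \<in> \<Union>?C" using q ES by (auto simp: vanishing_singleton_iff)
    qed
    have "openin (patch_topology R) U" if "U \<in> ?C" for U
      using that openin_patch_vanishing by auto
    then obtain C' where C': "finite C'" "C' \<subseteq> ?C" "E \<subseteq> \<Union>C'"
      using compactinD[OF closedin_compact_space[OF compact_space_patch E(1)] _ cov] by metis
    then obtain F where F: "finite F" "F \<subseteq> carrier R - p" "E \<subseteq> (\<Union>f\<in>F. vanishing R {f})"
      using finite_subset_image[OF C'(1,2)] by blast
    \<comment> \<open>The witness is the product of the elements of \<open>F\<close>, built by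
      induction from the empty product 1; it stays outside \<open>p\<close> because \<open>p\<close>
      is prime.\<close>
    have "\<exists>g\<in>carrier R - p. (\<Union>f\<in>F. vanishing R {f}) \<subseteq> vanishing R {g}"
      using F(1,2)
    proof induction
      case empty
      then show ?case using one_notin_Spec[OF pS] by auto
    next
      case (insert f F)
      then obtain g where g: "g \<in> carrier R - p" "(\<Union>f\<in>F. vanishing R {f}) \<subseteq> vanishing R {g}"
        by auto
      have f: "f \<in> carrier R - p" using insert by auto
      have "f \<otimes> g \<in> carrier R - p"
        using f g primeideal.I_prime[OF Spec_primeideal[OF pS]] by blast
      moreover have "vanishing R {f} \<union> vanishing R {g} \<subseteq> vanishing R {f \<otimes> g}"
        using f g vanishing_mult[of "{f}" R "{g}"] by simp
      ultimately show ?case using g by (intro bexI[of _ "f \<otimes> g"]) auto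
    qed
    then obtain g where "g \<in> carrier R - p" "E \<subseteq> vanishing R {g}" using F(3) by blast
    then have "g \<notin> p" "g \<in> \<Inter>E" by (auto simp: vanishing_singleton_iff)
    then show False using p by (auto simp: vanishing_def)
  qed
qed

text \<open>\<open>closedin_zariski_iff\<close> asks for a set of equations inside the carrier. The
  intersection over \<open>E\<close> is one as soon as \<open>E\<close> has a member; for empty
  \<open>E\<close> it would be the whole type, so that case is treated apart.\<close>

lemma (in cring) closedin_zariski_specialization_closure:
  assumes E: "closedin (patch_topology R) E"
  shows "closedin (zariski_topology R) (specialization_closure R E)"
proof (cases "E = {}")
  case True
  then show ?thesis by (simp add: specialization_closure_def)
next
  case False
  then obtain q where q: "q \<in> E" by blast
  then have "q \<in> Spec R" using closedin_subset[OF E] topspace_patch by blast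
  then have "q \<subseteq> carrier R" by (intro additive_subgroup.a_subset Spec_additive_subgroup)
  then have "\<Inter>E \<subseteq> carrier R" using q by blast
  then show ?thesis
    unfolding closedin_zariski_iff[OF is_cring] specialization_closure_eq_vanishing_Inter[OF E False]
    by blast
qed

section \<open>Flatness of the quotient by a pure ideal\<close>

text \<open>The preimage of \<open>T\<close> under \<open>h\<close> is a subgroup containing
  \<open>A\<close>. This reduces claims about \<open>tensor_kernel\<close> to the tensor
  relations.\<close>

lemma (in group) subgroup_hom_generate:
  assumes "h \<in> hom G H" "group H" "subgroup T H" "A \<subseteq> carrier G" "h ` A \<subseteq> T" "x \<in> generate G A"
  shows "h x \<in> T"
proof -
  interpret gh: group_hom G H h
    using assms by (simp add: group_hom_def group_hom_axioms_def is_group)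
  interpret T: subgroup T H by fact
  show ?thesis
    using assms(6)
  proof induction
    case (inv a)
    then have "h (inv a) = inv\<^bsub>H\<^esub> (h a)" using assms(4) by (intro gh.hom_inv) auto
    then show ?case using inv assms(5) by auto
  next
    case (eng a b)
    then show ?case using generate_in_carrier[OF assms(4)] by auto
  qed (use assms in auto)
qed

section \<open>Cosets of the tensor kernel in the free abelian group\<close>

lemma frag_diff_diff_in_free:
  "frag_of a - frag_of b - frag_of c \<in> carrier (free_Abelian_group S)"
  if "a \<in> S" "b \<in> S" "c \<in> S"
  using that keys_diff[of "frag_of a - frag_of b" "frag_of c"] keys_diff[of "frag_of a" "frag_of b"]
  by auto

lemma frag_diff_in_free:
  "frag_of a - frag_of b \<in> carrier (free_Abelian_group S)" if "a \<in> S" "b \<in> S"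
  using that keys_diff[of "frag_of a" "frag_of b"] by auto

lemma tensor_relations_subset:
  assumes "Module.module R M" "Module.module R N"
  shows "tensor_relations R M N \<subseteq> carrier (free_Abelian_group (carrier M \<times> carrier N))"
proof -
  interpret M: Module.module R M by fact
  interpret N: Module.module R N by fact
  show ?thesis
    unfolding tensor_relations_def
    by (auto simp del: carrier_free_Abelian_group_iff intro!: frag_diff_diff_in_free frag_diff_in_free)
qed

lemma subgroup_tensor_kernel:
  assumes "Module.module R M" "Module.module R N"
  shows "subgroup (tensor_kernel R M N) (free_Abelian_group (carrier M \<times> carrier N))"
  unfolding tensor_kernel_def
  by (rule group.generate_is_subgroup[OF group_free_Abelian_group tensor_relations_subset[OF assms]])

lemma subgroup_free_Abelian_diff:
  assumes "subgroup K (free_Abelian_group S)" "a \<in> K" "b \<in> K"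
  shows "a - b \<in> K"
proof -
  \<comment> \<open>The group inverse is rewritten as the ordinary minus for elements supported in
    \<open>S\<close>.\<close>
  have "Poly_Mapping.keys b \<subseteq> S" using subgroup.mem_carrier[OF assms(1,3)] by simp
  then show ?thesis
    using subgroup.m_closed[OF assms(1,2) subgroup.m_inv_closed[OF assms(1,3)]] by simp
qed

lemma subgroup_free_Abelian_add:
  assumes "subgroup K (free_Abelian_group S)" "a \<in> K" "b \<in> K"
  shows "a + b \<in> K"
  using subgroup.m_closed[OF assms] by simp

lemma free_Abelian_coset_eq_iff:
  assumes K: "subgroup K (free_Abelian_group S)"
    and "c \<in> carrier (free_Abelian_group S)" "d \<in> carrier (free_Abelian_group S)"
  shows "K #>\<^bsub>free_Abelian_group S\<^esub> c = K #>\<^bsub>free_Abelian_group S\<^esub> d \<longleftrightarrow> c - d \<in> K"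
proof -
  have "K #>\<^bsub>free_Abelian_group S\<^esub> c = (\<lambda>k. k + c) ` K" for c
    by (auto simp: r_coset_def)
  moreover have "(\<lambda>k. k + c) ` K = (\<lambda>k. k + d) ` K \<longleftrightarrow> c - d \<in> K"
  proof
    assume eq: "(\<lambda>k. k + c) ` K = (\<lambda>k. k + d) ` K"
    have "0 \<in> K" using subgroup.one_closed[OF K] by simp
    then have "0 + c \<in> (\<lambda>k. k + d) ` K" using eq by blast
    then show "c - d \<in> K" by auto
  next
    assume *: "c - d \<in> K"
    have "k + c \<in> (\<lambda>k. k + d) ` K" if "k \<in> K" for k
      using subgroup_free_Abelian_add[OF K that *] by (force simp: algebra_simps)
    moreover have "k + d \<in> (\<lambda>k. k + c) ` K" if "k \<in> K" for k
      using subgroup_free_Abelian_diff[OF K that *] by (force simp: algebra_simps)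
    ultimately show "(\<lambda>k. k + c) ` K = (\<lambda>k. k + d) ` K" by blast
  qed
  ultimately show ?thesis by simp
qed

section \<open>Maps induced on tensor products\<close>

lemma frag_extend_hom:
  assumes "f \<in> carrier N \<rightarrow> carrier N'"
  shows "frag_extend (\<lambda>(x, y). frag_of (x, f y))
    \<in> hom (free_Abelian_group (carrier M \<times> carrier N)) (free_Abelian_group (carrier M \<times> carrier N'))"
proof (rule homI)
  fix c assume "c \<in> carrier (free_Abelian_group (carrier M \<times> carrier N))"
  then have "Poly_Mapping.keys c \<subseteq> carrier M \<times> carrier N" by simp
  then show "frag_extend (\<lambda>(x, y). frag_of (x, f y)) c
      \<in> carrier (free_Abelian_group (carrier M \<times> carrier N'))"
    using assms keys_frag_extend[of "\<lambda>(x, y). frag_of (x, f y)" c] by fastforce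
qed (simp add: frag_extend_add)

text \<open>Linearity of \<open>f\<close> turns each of the three kinds of relations into a relation
  of the same kind, so generators of one kernel go to generators of the other. This makes the
  induced map independent of representatives.\<close>

lemma frag_extend_tensor_kernel:
  fixes M :: "('r, 'm) module" and N :: "('r, 'n) module" and N' :: "('r, 'k) module"
  assumes M: "Module.module R M" and N: "Module.module R N" and N': "Module.module R N'"
    and f: "f \<in> module_hom R N N'"
    and c: "c \<in> tensor_kernel R M N"
  shows "frag_extend (\<lambda>(x, y). frag_of (x, f y)) c \<in> tensor_kernel R M N'"
proof -
  interpret N: Module.module R N by fact
  interpret N': Module.module R N' by fact
  let ?\<phi> = "frag_extend (\<lambda>(x, y). frag_of (x, f y)) :: ('m \<times> 'n \<Rightarrow>\<^sub>0 int) \<Rightarrow> ('m \<times> 'k \<Rightarrow>\<^sub>0 int)"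
  have fc: "f y \<in> carrier N'" if "y \<in> carrier N" for y
    using f that by (auto simp: module_hom_def hom_def)
  have fadd: "f (y \<oplus>\<^bsub>N\<^esub> y') = f y \<oplus>\<^bsub>N'\<^esub> f y'" if "y \<in> carrier N" "y' \<in> carrier N" for y y'
    using f that by (auto simp: module_hom_def hom_def)
  have fsm: "f (r \<odot>\<^bsub>N\<^esub> y) = r \<odot>\<^bsub>N'\<^esub> f y" if "r \<in> carrier R" "y \<in> carrier N" for r y
    using f that by (auto simp: module_hom_def)
  have rel: "?\<phi> ` tensor_relations R M N \<subseteq> tensor_relations R M N'"
  proof (rule image_subsetI)
    fix t assume "t \<in> tensor_relations R M N"
    then consider
      (add_l) x x' y where "t = frag_of (x \<oplus>\<^bsub>M\<^esub> x', y) - frag_of (x, y) - frag_of (x', y)"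
        "x \<in> carrier M" "x' \<in> carrier M" "y \<in> carrier N"
    | (add_r) x y y' where "t = frag_of (x, y \<oplus>\<^bsub>N\<^esub> y') - frag_of (x, y) - frag_of (x, y')"
        "x \<in> carrier M" "y \<in> carrier N" "y' \<in> carrier N"
    | (smult) r x y where "t = frag_of (r \<odot>\<^bsub>M\<^esub> x, y) - frag_of (x, r \<odot>\<^bsub>N\<^esub> y)"
        "r \<in> carrier R" "x \<in> carrier M" "y \<in> carrier N"
      unfolding tensor_relations_def by blast
    then show "?\<phi> t \<in> tensor_relations R M N'"
    proof cases
      case add_l
      have "?\<phi> t = frag_of (x \<oplus>\<^bsub>M\<^esub> x', f y) - frag_of (x, f y) - frag_of (x', f y)"
        by (simp add: add_l(1) frag_extend_diff)
      then show ?thesis unfolding tensor_relations_def using add_l fc by blast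
    next
      case add_r
      have "?\<phi> t = frag_of (x, f y \<oplus>\<^bsub>N'\<^esub> f y') - frag_of (x, f y) - frag_of (x, f y')"
        by (simp add: add_r frag_extend_diff fadd)
      then show ?thesis unfolding tensor_relations_def using add_r fc by blast
    next
      case smult
      have "?\<phi> t = frag_of (r \<odot>\<^bsub>M\<^esub> x, f y) - frag_of (x, r \<odot>\<^bsub>N'\<^esub> f y)"
        by (simp add: smult frag_extend_diff fsm)
      then show ?thesis unfolding tensor_relations_def using smult fc by blast
    qed
  qed
  have hom: "?\<phi> \<in> hom (free_Abelian_group (carrier M \<times> carrier N))
      (free_Abelian_group (carrier M \<times> carrier N'))"
    using fc by (intro frag_extend_hom) blast
  have "tensor_relations R M N' \<subseteq> tensor_kernel R M N'"
    unfolding tensor_kernel_def by (auto intro: generate.incl)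
  then have "?\<phi> ` tensor_relations R M N \<subseteq> tensor_kernel R M N'" using rel by blast
  then show ?thesis
    by (rule group.subgroup_hom_generate[OF group_free_Abelian_group hom group_free_Abelian_group
          subgroup_tensor_kernel[OF M N'] tensor_relations_subset[OF M N] _ c[unfolded tensor_kernel_def]])
qed

text \<open>\<open>tensor_map\<close> is a union over all representatives of a coset. Two
  representatives differ by an element of the kernel, so all members of the union coincide with the
  one for \<open>c\<close>.\<close>

lemma tensor_map_coset:
  fixes M :: "('r, 'm) module" and N :: "('r, 'n) module" and N' :: "('r, 'k) module"
  assumes M: "Module.module R M" and N: "Module.module R N" and N': "Module.module R N'"
    and f: "f \<in> module_hom R N N'"
    and c: "c \<in> carrier (free_Abelian_group (carrier M \<times> carrier N))"
  shows "tensor_map R M N N' f (tensor_kernel R M N #>\<^bsub>free_Abelian_group (carrier M \<times> carrier N)\<^esub> c)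
    = tensor_kernel R M N' #>\<^bsub>free_Abelian_group (carrier M \<times> carrier N')\<^esub>
        frag_extend (\<lambda>(x, y). frag_of (x, f y)) c"
proof -
  let ?F = "free_Abelian_group (carrier M \<times> carrier N)"
  let ?F' = "free_Abelian_group (carrier M \<times> carrier N')"
  let ?K = "tensor_kernel R M N" and ?K' = "tensor_kernel R M N'"
  let ?\<phi> = "frag_extend (\<lambda>(x, y). frag_of (x, f y)) :: ('m \<times> 'n \<Rightarrow>\<^sub>0 int) \<Rightarrow> ('m \<times> 'k \<Rightarrow>\<^sub>0 int)"
  have "f \<in> carrier N \<rightarrow> carrier N'" using f by (auto simp: module_hom_def hom_def)
  note hom = frag_extend_hom[OF this, of M]
  have const: "?K' #>\<^bsub>?F'\<^esub> ?\<phi> d = ?K' #>\<^bsub>?F'\<^esub> ?\<phi> c" if d: "d \<in> ?K #>\<^bsub>?F\<^esub> c" for d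
  proof -
    obtain k where k: "k \<in> ?K" "d = k + c" using d by (auto simp: r_coset_def)
    then have kF: "k \<in> carrier ?F" using subgroup.mem_carrier[OF subgroup_tensor_kernel[OF M N]] by blast
    have dF: "d \<in> carrier ?F"
      using monoid.m_closed[OF group.is_monoid[OF group_free_Abelian_group] kF c] k by simp
    have "?\<phi> d - ?\<phi> c = ?\<phi> k" using k by (simp add: frag_extend_add)
    then have "?\<phi> d - ?\<phi> c \<in> ?K'" using frag_extend_tensor_kernel[OF M N N' f k(1)] by simp
    then show ?thesis
      using free_Abelian_coset_eq_iff[OF subgroup_tensor_kernel[OF M N'] hom_in_carrier[OF hom dF]
          hom_in_carrier[OF hom c]] by blast
  qed
  \<comment> \<open>The union is over a nonempty set, so it equals its constant member.\<close>
  have "c \<in> ?K #>\<^bsub>?F\<^esub> c"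
    using subgroup.one_closed[OF subgroup_tensor_kernel[OF M N]] by (force simp: r_coset_def)
  then show ?thesis unfolding tensor_map_def using const by blast
qed

section \<open>Pure ideals and the submodule JN\<close>

locale pure_ideal = ideal J R + cring R for J and R (structure) +
  assumes pure: "a \<in> J \<Longrightarrow> \<exists>b\<in>J. b \<otimes> a = a"

text \<open>When \<open>J\<close> is pure, this is the submodule \<open>JN\<close>.\<close>

definition fixed_part :: "('r, 'e) ring_scheme \<Rightarrow> 'r set \<Rightarrow> ('r, 'n) module \<Rightarrow> 'n set" where
  "fixed_part R J N = {n \<in> carrier N. \<exists>b\<in>J. b \<odot>\<^bsub>N\<^esub> n = n}"

context pure_ideal
begin

text \<open>A single multiplier for two elements is what makes \<open>fixed_part\<close> closed
  under sums.\<close>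

lemma pure_two:
  assumes "a \<in> J" "b \<in> J"
  obtains c where "c \<in> J" "c \<otimes> a = a" "c \<otimes> b = b"
proof -
  obtain d d' where d: "d \<in> J" "d \<otimes> a = a" "d' \<in> J" "d' \<otimes> b = b" using pure assms by metis
  have carr: "a \<in> carrier R" "b \<in> carrier R" "d \<in> carrier R" "d' \<in> carrier R"
    using assms d Icarr by auto
  \<comment> \<open>Chosen so that 1 - c = (1 - d)(1 - d'), which kills both \<open>a\<close> and
    \<open>b\<close>.\<close>
  let ?c = "d \<oplus> d' \<ominus> d \<otimes> d'"
  have "?c \<otimes> a = d \<otimes> a \<oplus> d' \<otimes> a \<ominus> d' \<otimes> (d \<otimes> a)"
    "?c \<otimes> b = d \<otimes> b \<oplus> d' \<otimes> b \<ominus> d \<otimes> (d' \<otimes> b)"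
    using carr by algebra+
  moreover have "a \<oplus> d' \<otimes> a \<ominus> d' \<otimes> a = a" "d \<otimes> b \<oplus> b \<ominus> d \<otimes> b = b"
    using carr by algebra+
  moreover have "?c \<in> J" unfolding a_minus_def
    using additive_subgroup.a_closed[OF additive_subgroup_axioms]
      additive_subgroup.a_inv_closed[OF additive_subgroup_axioms] I_l_closed d carr by metis
  ultimately show thesis using that d by simp
qed

text \<open>A multiplier in \<open>J\<close> that fixes \<open>a\<close> also fixes
  \<open>a n\<close>.\<close>

lemma smult_fixed_part:
  assumes "Module.module R N" "a \<in> J" "n \<in> carrier N"
  shows "a \<odot>\<^bsub>N\<^esub> n \<in> fixed_part R J N"
proof -
  interpret N: Module.module R N by fact
  obtain b where b: "b \<in> J" "b \<otimes> a = a" using pure assms by blast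
  then have "b \<odot>\<^bsub>N\<^esub> (a \<odot>\<^bsub>N\<^esub> n) = a \<odot>\<^bsub>N\<^esub> n"
    using N.smult_assoc1[of b a n] assms Icarr by simp
  moreover have "a \<odot>\<^bsub>N\<^esub> n \<in> carrier N" using assms Icarr by simp
  ultimately show ?thesis unfolding fixed_part_def using b(1) by blast
qed

lemma subgroup_fixed_part:
  assumes "Module.module R N"
  shows "subgroup (fixed_part R J N) (add_monoid N)"
proof -
  interpret N: Module.module R N by fact
  show ?thesis
  proof (rule N.add.subgroupI)
    show "fixed_part R J N \<subseteq> carrier N" by (auto simp: fixed_part_def)
    show "fixed_part R J N \<noteq> {}"
      using smult_fixed_part[OF assms additive_subgroup.zero_closed N.zero_closed]
      additive_subgroup_axioms by blast
  next
    fix n assume "n \<in> fixed_part R J N"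
    then obtain b where "b \<in> J" "n \<in> carrier N" "b \<odot>\<^bsub>N\<^esub> n = n" by (auto simp: fixed_part_def)
    then show "\<ominus>\<^bsub>N\<^esub> n \<in> fixed_part R J N"
      unfolding fixed_part_def using N.smult_r_minus[of b n] Icarr by force
  next
    fix n n' assume "n \<in> fixed_part R J N" "n' \<in> fixed_part R J N"
    then obtain b b' where b: "b \<in> J" "n \<in> carrier N" "b \<odot>\<^bsub>N\<^esub> n = n"
      "b' \<in> J" "n' \<in> carrier N" "b' \<odot>\<^bsub>N\<^esub> n' = n'" by (auto simp: fixed_part_def)
    \<comment> \<open>The common multiplier is taken for \<open>b\<close> and \<open>b'\<close>,
      elements of \<open>J\<close>; it then fixes \<open>n\<close> because c n = c (b n) = (c b) n =
      b n = n, and likewise \<open>n'\<close>.\<close>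
    obtain c where c: "c \<in> J" "c \<otimes> b = b" "c \<otimes> b' = b'" using pure_two b by metis
    have "c \<odot>\<^bsub>N\<^esub> n = n" "c \<odot>\<^bsub>N\<^esub> n' = n'"
      using N.smult_assoc1[of c b n] N.smult_assoc1[of c b' n'] b c Icarr by auto
    then have "c \<odot>\<^bsub>N\<^esub> (n \<oplus>\<^bsub>N\<^esub> n') = n \<oplus>\<^bsub>N\<^esub> n'"
      using N.smult_r_distr[of c n n'] b c Icarr by auto
    then show "n \<oplus>\<^bsub>N\<^esub> n' \<in> fixed_part R J N" unfolding fixed_part_def using b c by blast
  qed
qed

end

section \<open>The module structure of the quotient by an ideal\<close>

context ideal
begin

lemma quotient_module_simps:
  "carrier (quotient_module R I) = {I +> r |r. r \<in> carrier R}"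
  "\<zero>\<^bsub>quotient_module R I\<^esub> = I"
  by (auto simp: quotient_module_def ring.defs Module.module.defs FactRing_def A_RCOSETS_def' a_r_coset_def')

lemma quotient_module_add:
  assumes "r \<in> carrier R" "s \<in> carrier R"
  shows "(I +> r) \<oplus>\<^bsub>quotient_module R I\<^esub> (I +> s) = I +> (r \<oplus> s)"
  using a_rcos_sum[OF assms]
  by (simp add: quotient_module_def ring.defs Module.module.defs FactRing_def)

lemma quotient_module_smult:
  assumes "r \<in> carrier R" "s \<in> carrier R"
  shows "r \<odot>\<^bsub>quotient_module R I\<^esub> (I +> s) = I +> (r \<otimes> s)"
  using rcoset_mult_add[OF assms]
  by (simp add: quotient_module_def ring.defs Module.module.defs FactRing_def)

lemma module_quotient_module:
  assumes "cring R"
  shows "Module.module R (quotient_module R I)"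
proof -
  interpret cring R by fact
  let ?Q = "quotient_module R I"
  have ab: "abelian_group ?Q"
  proof (rule abelian_groupI)
    \<comment> \<open>The zero of the quotient is the set \<open>I\<close>; it has to be recognised
      as the class of 0 before the rules for classes apply.\<close>
    have "I +> \<zero> = I" using a_rcos_zero[OF is_ideal additive_subgroup.zero_closed[OF additive_subgroup_axioms]] .
    then show "\<zero>\<^bsub>?Q\<^esub> \<in> carrier ?Q"
      unfolding quotient_module_simps by blast
    fix X assume X: "X \<in> carrier ?Q"
    then obtain r where r: "r \<in> carrier R" "X = I +> r" by (auto simp: quotient_module_simps)
    show "\<zero>\<^bsub>?Q\<^esub> \<oplus>\<^bsub>?Q\<^esub> X = X"
      using quotient_module_add[of \<zero> r] r \<open>I +> \<zero> = I\<close> by (simp add: quotient_module_simps)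
    show "\<exists>Y\<in>carrier ?Q. Y \<oplus>\<^bsub>?Q\<^esub> X = \<zero>\<^bsub>?Q\<^esub>"
    proof
      show "I +> (\<ominus> r) \<in> carrier ?Q" using r by (auto simp: quotient_module_simps)
      show "(I +> (\<ominus> r)) \<oplus>\<^bsub>?Q\<^esub> X = \<zero>\<^bsub>?Q\<^esub>"
        using r \<open>I +> \<zero> = I\<close> by (simp add: quotient_module_add l_neg quotient_module_simps)
    qed
  qed (auto simp: quotient_module_simps(1) quotient_module_add a_ac)
  show ?thesis
    by (rule moduleI[OF is_cring ab])
      (auto simp: quotient_module_simps(1) quotient_module_smult quotient_module_add
         l_distr r_distr m_assoc)
qed

end

section \<open>Elementary relations between tensors\<close>

lemma tensor_kernel_add_left:
  assumes "x \<in> carrier M" "x' \<in> carrier M" "y \<in> carrier N"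
  shows "frag_of (x \<oplus>\<^bsub>M\<^esub> x', y) - frag_of (x, y) - frag_of (x', y) \<in> tensor_kernel R M N"
  unfolding tensor_kernel_def tensor_relations_def using assms by (intro generate.incl) blast

lemma tensor_kernel_add_right:
  assumes "x \<in> carrier M" "y \<in> carrier N" "y' \<in> carrier N"
  shows "frag_of (x, y \<oplus>\<^bsub>N\<^esub> y') - frag_of (x, y) - frag_of (x, y') \<in> tensor_kernel R M N"
  unfolding tensor_kernel_def tensor_relations_def using assms by (intro generate.incl) blast

lemma tensor_kernel_smult:
  assumes "r \<in> carrier R" "x \<in> carrier M" "y \<in> carrier N"
  shows "frag_of (r \<odot>\<^bsub>M\<^esub> x, y) - frag_of (x, r \<odot>\<^bsub>N\<^esub> y) \<in> tensor_kernel R M N"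
  unfolding tensor_kernel_def tensor_relations_def using assms by (intro generate.incl) blast

text \<open>The additivity relation for 0 + 0 reduces to minus the generator (0, y).\<close>

lemma tensor_kernel_zero_left:
  assumes "Module.module R M" "Module.module R N" "y \<in> carrier N"
  shows "frag_of (\<zero>\<^bsub>M\<^esub>, y) \<in> tensor_kernel R M N"
proof -
  interpret M: Module.module R M by fact
  note K = subgroup_tensor_kernel[OF assms(1,2)]
  have "- frag_of (\<zero>\<^bsub>M\<^esub>, y) \<in> tensor_kernel R M N"
    using tensor_kernel_add_left[OF M.M.zero_closed M.M.zero_closed assms(3), of R] by simp
  then show ?thesis
    using subgroup_free_Abelian_diff[OF K, of 0] subgroup.one_closed[OF K] by fastforce
qed

lemma tensor_kernel_zero_right:
  assumes "Module.module R M" "Module.module R N" "x \<in> carrier M"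
  shows "frag_of (x, \<zero>\<^bsub>N\<^esub>) \<in> tensor_kernel R M N"
proof -
  interpret N: Module.module R N by fact
  note K = subgroup_tensor_kernel[OF assms(1,2)]
  have "- frag_of (x, \<zero>\<^bsub>N\<^esub>) \<in> tensor_kernel R M N"
    using tensor_kernel_add_right[OF assms(3) N.M.zero_closed N.M.zero_closed, of R] by simp
  then show ?thesis
    using subgroup_free_Abelian_diff[OF K, of 0] subgroup.one_closed[OF K] by fastforce
qed

lemma tensor_kernel_diff_right:
  assumes "Module.module R M" "Module.module R N" "x \<in> carrier M" "y \<in> carrier N" "y' \<in> carrier N"
  shows "frag_of (x, y) - frag_of (x, y') - frag_of (x, y \<ominus>\<^bsub>N\<^esub> y') \<in> tensor_kernel R M N"
proof -
  interpret N: Module.module R N by fact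
  have "(y \<ominus>\<^bsub>N\<^esub> y') \<oplus>\<^bsub>N\<^esub> y' = y"
    using assms by (simp add: a_minus_def N.M.a_assoc N.M.l_neg)
  then have "frag_of (x, y) - frag_of (x, y \<ominus>\<^bsub>N\<^esub> y') - frag_of (x, y') \<in> tensor_kernel R M N"
    using tensor_kernel_add_right[of x M "y \<ominus>\<^bsub>N\<^esub> y'" N y' R] assms by simp
  then show ?thesis by (simp add: algebra_simps)
qed

lemma (in abelian_group) hom_free_Abelian_diff:
  assumes h: "h \<in> hom (free_Abelian_group S) (add_monoid G)"
    and "a \<in> carrier (free_Abelian_group S)" "b \<in> carrier (free_Abelian_group S)"
  shows "h (a - b) = h a \<ominus> h b"
proof -
  interpret gh: group_hom "free_Abelian_group S" "add_monoid G" h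
    using h a_group by (simp add: group_hom_def group_hom_axioms_def)
  have "a - b = a \<otimes>\<^bsub>free_Abelian_group S\<^esub> inv\<^bsub>free_Abelian_group S\<^esub> b"
    using assms(3) by simp
  then have "h (a - b) = h a \<oplus> inv\<^bsub>add_monoid G\<^esub> h b"
    using gh.hom_mult[OF assms(2) group.inv_closed[OF group_free_Abelian_group assms(3)]]
      gh.hom_inv[OF assms(3)] by (simp only: monoid.simps)
  then show ?thesis by (simp add: a_minus_def a_inv_def)
qed

section \<open>Tensoring with the quotient\<close>

context ideal
begin

text \<open>Moving \<open>r\<close> across the tensor sign turns the class of \<open>r\<close>
  tensor \<open>n\<close> into the class of 1 tensor \<open>r n\<close>, and tensors of the latter
  shape are closed under differences.\<close>

lemma quotient_module_tensor_elem:
  assumes "cring R" and N: "Module.module R N"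
    and c: "c \<in> carrier (free_Abelian_group (carrier (quotient_module R I) \<times> carrier N))"
  shows "\<exists>n\<in>carrier N. c - frag_of (I +> \<one>, n) \<in> tensor_kernel R (quotient_module R I) N"
proof -
  let ?Q = "quotient_module R I" and ?e = "I +> \<one>"
  let ?K = "tensor_kernel R ?Q N"
  note Q = module_quotient_module[OF assms(1)]
  interpret N: Module.module R N by fact
  note K = subgroup_tensor_kernel[OF Q N]
  have e: "?e \<in> carrier ?Q" by (auto simp: quotient_module_simps)
  have "Poly_Mapping.keys c \<subseteq> carrier ?Q \<times> carrier N" using c by simp
  then show ?thesis
  \<comment> \<open>This induction runs over zero, differences and generators.\<close>
  proof (rule free_Abelian_group_induct)
    have "0 - frag_of (?e, \<zero>\<^bsub>N\<^esub>) \<in> ?K"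
      using subgroup_free_Abelian_diff[OF K subgroup.one_closed[OF K]
          tensor_kernel_zero_right[OF Q N e]] by simp
    then show "\<exists>n\<in>carrier N. 0 - frag_of (?e, n) \<in> ?K" using N.M.zero_closed by blast
  next
    fix x y
    assume "\<exists>n\<in>carrier N. x - frag_of (?e, n) \<in> ?K" "\<exists>n\<in>carrier N. y - frag_of (?e, n) \<in> ?K"
    then obtain n m where n: "n \<in> carrier N" "x - frag_of (?e, n) \<in> ?K"
      and m: "m \<in> carrier N" "y - frag_of (?e, m) \<in> ?K" by blast
    \<comment> \<open>The terms in \<open>n\<close> and \<open>m\<close> cancel, leaving the
      relation wanted for \<open>x - y\<close>.\<close>
    have "(x - frag_of (?e, n)) - (y - frag_of (?e, m))
        + (frag_of (?e, n) - frag_of (?e, m) - frag_of (?e, n \<ominus>\<^bsub>N\<^esub> m)) \<in> ?K"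
      by (rule subgroup_free_Abelian_add[OF K subgroup_free_Abelian_diff[OF K n(2) m(2)]
            tensor_kernel_diff_right[OF Q N e n(1) m(1)]])
    then have "x - y - frag_of (?e, n \<ominus>\<^bsub>N\<^esub> m) \<in> ?K" by (simp add: algebra_simps)
    then show "\<exists>n\<in>carrier N. x - y - frag_of (?e, n) \<in> ?K"
      using n m N.M.minus_closed by blast
  next
    fix a assume "a \<in> carrier ?Q \<times> carrier N"
    then obtain r n where a: "a = (I +> r, n)" "r \<in> carrier R" "n \<in> carrier N"
      by (auto simp: quotient_module_simps)
    have "r \<odot>\<^bsub>?Q\<^esub> ?e = I +> r" using quotient_module_smult[OF a(2) one_closed] a(2) by simp
    then have "frag_of a - frag_of (?e, r \<odot>\<^bsub>N\<^esub> n) \<in> ?K"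
      using tensor_kernel_smult[OF a(2) e a(3)] a(1) by simp
    then show "\<exists>n\<in>carrier N. frag_of a - frag_of (?e, n) \<in> ?K" using a N.smult_closed by blast
  qed
qed

end

context pure_ideal
begin

text \<open>The additive extension \<open>h\<close> of \<open>(J + r, n) \<mapsto> r n\<close> depends on the choice of representatives, but
  only up to multiples of elements of \<open>J\<close>, that is, modulo \<^term>\<open>fixed_part R J N\<close>; hence it maps
  the tensor relations into that submodule.\<close>

lemma one_tensor_in_kernel_iff:
  assumes N: "Module.module R N" and n: "n \<in> carrier N"
  shows "frag_of (J +> \<one>, n) \<in> tensor_kernel R (quotient_module R J) N \<longleftrightarrow> n \<in> fixed_part R J N"
proof
  let ?Q = "quotient_module R J" and ?e = "J +> \<one>"
  let ?K = "tensor_kernel R ?Q N" and ?T = "fixed_part R J N"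
  note Q = module_quotient_module[OF is_cring]
  interpret Q: Module.module R ?Q by (rule Q)
  interpret N: Module.module R N by fact
  note K = subgroup_tensor_kernel[OF Q N] and T = subgroup_fixed_part[OF N]
  have e: "?e \<in> carrier ?Q" by (auto simp: quotient_module_simps)
  {
    assume "n \<in> ?T"
    then obtain b where b: "b \<in> J" "b \<odot>\<^bsub>N\<^esub> n = n" by (auto simp: fixed_part_def)
    have bR: "b \<in> carrier R" using b Icarr by blast
    \<comment> \<open>As \<open>b\<close> annihilates the class of 1, the tensor of that class with
      \<open>n = b n\<close> equals a tensor with zero on the left.\<close>
    have "b \<odot>\<^bsub>?Q\<^esub> ?e = \<zero>\<^bsub>?Q\<^esub>"
      using quotient_module_smult[OF bR one_closed] a_rcos_zero[OF is_ideal b(1)] bR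
      by (simp add: quotient_module_simps)
    then have "frag_of (\<zero>\<^bsub>?Q\<^esub>, n) - frag_of (?e, n) \<in> ?K"
      using tensor_kernel_smult[OF bR e n] b(2) by simp
    then show "frag_of (?e, n) \<in> ?K"
      using subgroup_free_Abelian_diff[OF K tensor_kernel_zero_left[OF Q N n]] by fastforce
  next
    assume in_K: "frag_of (?e, n) \<in> ?K"
    define rep where "rep X = (SOME r. r \<in> carrier R \<and> X = J +> r)" for X
    have rep: "rep X \<in> carrier R" "J +> rep X = X" if "X \<in> carrier ?Q" for X
    proof -
      have "\<exists>r. r \<in> carrier R \<and> X = J +> r" using that by (auto simp: quotient_module_simps)
      then show "rep X \<in> carrier R" "J +> rep X = X"
        unfolding rep_def by (metis (mono_tags, lifting) someI_ex)+
    qed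
    \<comment> \<open>Two representatives of one class differ by an element of \<open>J\<close>, so
      their actions on \<open>y\<close> differ by an element of JN.\<close>
    have same: "r \<odot>\<^bsub>N\<^esub> y \<ominus>\<^bsub>N\<^esub> s \<odot>\<^bsub>N\<^esub> y \<in> ?T"
      if "r \<in> carrier R" "s \<in> carrier R" "J +> r = J +> s" "y \<in> carrier N" for r s y
    proof -
      have "r \<ominus> s \<in> J" using quotient_eq_iff_same_a_r_cos[OF is_ideal] that by blast
      then have "(r \<ominus> s) \<odot>\<^bsub>N\<^esub> y \<in> ?T" using smult_fixed_part[OF N] that by blast
      then show ?thesis
        using that by (simp add: a_minus_def N.smult_l_distr N.smult_l_minus)
    qed
    let ?g = "\<lambda>(X, y). rep X \<odot>\<^bsub>N\<^esub> y"
    have "?g ` (carrier ?Q \<times> carrier N) \<subseteq> carrier (add_monoid N)" using rep by auto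
    then obtain h where h: "h \<in> hom (free_Abelian_group (carrier ?Q \<times> carrier N)) (add_monoid N)"
      and "\<And>x. x \<in> carrier ?Q \<times> carrier N \<Longrightarrow> h (frag_of x) = ?g x"
      using comm_group.free_Abelian_group_universal[OF N.M.a_comm_group] by blast
    then have h_of: "h (frag_of (X, y)) = rep X \<odot>\<^bsub>N\<^esub> y"
      if "X \<in> carrier ?Q" "y \<in> carrier N" for X y
      using that by fastforce
    have h_diff: "h (frag_of a - frag_of b) = h (frag_of a) \<ominus>\<^bsub>N\<^esub> h (frag_of b)"
      if "a \<in> carrier ?Q \<times> carrier N" "b \<in> carrier ?Q \<times> carrier N" for a b
      using N.M.hom_free_Abelian_diff[OF h] that by simp
    have h_diff2: "h (frag_of a - frag_of b - frag_of c)
        = h (frag_of a) \<ominus>\<^bsub>N\<^esub> h (frag_of b) \<ominus>\<^bsub>N\<^esub> h (frag_of c)"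
      if "a \<in> carrier ?Q \<times> carrier N" "b \<in> carrier ?Q \<times> carrier N" "c \<in> carrier ?Q \<times> carrier N"
      for a b c
      using N.M.hom_free_Abelian_diff[OF h frag_diff_in_free[OF that(1,2)], of "frag_of c"]
        h_diff that by simp
    have "h ` tensor_relations R ?Q N \<subseteq> ?T"
    proof (rule image_subsetI)
      fix t assume "t \<in> tensor_relations R ?Q N"
      then consider
        (add_l) X X' y where "t = frag_of (X \<oplus>\<^bsub>?Q\<^esub> X', y) - frag_of (X, y) - frag_of (X', y)"
          "X \<in> carrier ?Q" "X' \<in> carrier ?Q" "y \<in> carrier N"
      | (add_r) X y y' where "t = frag_of (X, y \<oplus>\<^bsub>N\<^esub> y') - frag_of (X, y) - frag_of (X, y')"
          "X \<in> carrier ?Q" "y \<in> carrier N" "y' \<in> carrier N"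
      | (smult) r X y where "t = frag_of (r \<odot>\<^bsub>?Q\<^esub> X, y) - frag_of (X, r \<odot>\<^bsub>N\<^esub> y)"
          "r \<in> carrier R" "X \<in> carrier ?Q" "y \<in> carrier N"
        unfolding tensor_relations_def by blast
      then show "h t \<in> ?T"
      proof cases
        case add_l
        have sum: "X \<oplus>\<^bsub>?Q\<^esub> X' \<in> carrier ?Q" by (rule Q.M.a_closed[OF add_l(2,3)])
        have eq: "J +> rep (X \<oplus>\<^bsub>?Q\<^esub> X') = J +> (rep X \<oplus> rep X')"
          unfolding rep(2)[OF sum]
          using quotient_module_add[OF rep(1)[OF add_l(2)] rep(1)[OF add_l(3)]]
          by (simp only: rep(2)[OF add_l(2)] rep(2)[OF add_l(3)])
        \<comment> \<open>The chosen representative of the sum and the sum of the chosen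
          representatives need not agree, but they lie in one class; the resulting error is exactly
          \<open>h t\<close>.\<close>
        have "rep (X \<oplus>\<^bsub>?Q\<^esub> X') \<odot>\<^bsub>N\<^esub> y \<ominus>\<^bsub>N\<^esub> (rep X \<oplus> rep X') \<odot>\<^bsub>N\<^esub> y \<in> ?T"
          by (rule same[OF rep(1)[OF sum] _ eq add_l(4)]) (simp add: rep(1) add_l)
        moreover have "h t = rep (X \<oplus>\<^bsub>?Q\<^esub> X') \<odot>\<^bsub>N\<^esub> y \<ominus>\<^bsub>N\<^esub> rep X \<odot>\<^bsub>N\<^esub> y \<ominus>\<^bsub>N\<^esub> rep X' \<odot>\<^bsub>N\<^esub> y"
          using add_l by (simp add: h_diff2 h_of)
        ultimately show ?thesis
          using rep add_l by (simp add: N.smult_l_distr a_minus_def N.M.minus_add N.M.a_assoc)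
      next
        case add_r
        \<comment> \<open>Only one representative occurs here, so the relation is respected
          exactly.\<close>
        have "h t = \<zero>\<^bsub>N\<^esub>"
          using rep add_r
          by (simp add: h_diff2 h_of N.smult_r_distr a_minus_def N.M.a_ac N.M.r_neg N.M.r_neg1 N.M.r_neg2)
        then show ?thesis using subgroup.one_closed[OF T] by simp
      next
        case smult
        have prod: "r \<odot>\<^bsub>?Q\<^esub> X \<in> carrier ?Q" by (rule Q.smult_closed[OF smult(2,3)])
        have eq: "J +> rep (r \<odot>\<^bsub>?Q\<^esub> X) = J +> (r \<otimes> rep X)"
          unfolding rep(2)[OF prod]
          using quotient_module_smult[OF smult(2) rep(1)[OF smult(3)]]
          by (simp only: rep(2)[OF smult(3)])
        have "rep (r \<odot>\<^bsub>?Q\<^esub> X) \<odot>\<^bsub>N\<^esub> y \<ominus>\<^bsub>N\<^esub> (r \<otimes> rep X) \<odot>\<^bsub>N\<^esub> y \<in> ?T"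
          by (rule same[OF rep(1)[OF prod] _ eq smult(4)]) (simp add: rep(1) smult)
        moreover have "h t = rep (r \<odot>\<^bsub>?Q\<^esub> X) \<odot>\<^bsub>N\<^esub> y \<ominus>\<^bsub>N\<^esub> rep X \<odot>\<^bsub>N\<^esub> (r \<odot>\<^bsub>N\<^esub> y)"
          using smult by (simp add: h_diff h_of)
        ultimately show ?thesis
          using rep smult N.smult_assoc1[of "rep X" r y] by (simp add: m_comm[of r])
      qed
    qed
    then have "h (frag_of (?e, n)) \<in> ?T"
      by (rule group.subgroup_hom_generate[OF group_free_Abelian_group h N.M.a_group T
            tensor_relations_subset[OF Q N] _ in_K[unfolded tensor_kernel_def]])
    then have "rep ?e \<odot>\<^bsub>N\<^esub> n \<in> ?T" using h_of e n by simp
    \<comment> \<open>The representative chosen for the class of 1 may differ from 1, so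
      \<open>h\<close> yields \<open>n\<close> only up to an element of JN.\<close>
    moreover have "\<one> \<odot>\<^bsub>N\<^esub> n \<ominus>\<^bsub>N\<^esub> rep ?e \<odot>\<^bsub>N\<^esub> n \<in> ?T"
      by (rule same[OF one_closed rep(1)[OF e] _ n]) (simp only: rep(2)[OF e])
    ultimately have "(n \<ominus>\<^bsub>N\<^esub> rep ?e \<odot>\<^bsub>N\<^esub> n) \<oplus>\<^bsub>N\<^esub> rep ?e \<odot>\<^bsub>N\<^esub> n \<in> ?T"
      using subgroup.m_closed[OF T] n by simp
    then show "n \<in> ?T"
      using rep[OF e] n by (simp add: a_minus_def N.M.a_assoc N.M.l_neg)
  }
qed

text \<open>Surjectivity of the map from N to R/J (x) N. It lets image and kernel in the exactness
  claim be described by elements of the modules.\<close>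

lemma carrier_tensor_product_quotient:
  assumes N: "Module.module R N"
  shows "carrier (tensor_product R (quotient_module R J) N) =
    (\<lambda>n. tensor_kernel R (quotient_module R J) N
       #>\<^bsub>free_Abelian_group (carrier (quotient_module R J) \<times> carrier N)\<^esub> frag_of (J +> \<one>, n)) ` carrier N"
proof -
  let ?Q = "quotient_module R J" and ?e = "J +> \<one>"
  let ?F = "free_Abelian_group (carrier ?Q \<times> carrier N)" and ?K = "tensor_kernel R ?Q N"
  note K = subgroup_tensor_kernel[OF module_quotient_module[OF is_cring] N]
  have e: "?e \<in> carrier ?Q" by (auto simp: quotient_module_simps)
  have eq: "carrier (tensor_product R ?Q N) = (\<lambda>c. ?K #>\<^bsub>?F\<^esub> c) ` carrier ?F"
    by (simp add: tensor_product_def carrier_FactGroup)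
  show ?thesis
  proof (intro equalityI subsetI)
    fix X assume "X \<in> carrier (tensor_product R ?Q N)"
    then obtain c where c: "c \<in> carrier ?F" "X = ?K #>\<^bsub>?F\<^esub> c" unfolding eq by blast
    obtain n where n: "n \<in> carrier N" "c - frag_of (?e, n) \<in> ?K"
      using quotient_module_tensor_elem[OF is_cring N c(1)] by blast
    then have "X = ?K #>\<^bsub>?F\<^esub> frag_of (?e, n)"
      using free_Abelian_coset_eq_iff[OF K c(1), of "frag_of (?e, n)"] c(2) e by simp
    then show "X \<in> (\<lambda>n. ?K #>\<^bsub>?F\<^esub> frag_of (?e, n)) ` carrier N" using n by blast
  next
    fix X assume "X \<in> (\<lambda>n. ?K #>\<^bsub>?F\<^esub> frag_of (?e, n)) ` carrier N"
    then obtain n where "n \<in> carrier N" "X = ?K #>\<^bsub>?F\<^esub> frag_of (?e, n)" by blast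
    moreover have "frag_of (?e, n) \<in> carrier ?F" using calculation e by simp
    ultimately show "X \<in> carrier (tensor_product R ?Q N)" unfolding eq by blast
  qed
qed

text \<open>This says that n \<mapsto> 1 (x) n is well defined on N/JN.\<close>

lemma one_tensor_coset_eq:
  assumes N: "Module.module R N" and "n \<in> carrier N" "m \<in> carrier N"
    and nm: "n \<ominus>\<^bsub>N\<^esub> m \<in> fixed_part R J N"
  shows "tensor_kernel R (quotient_module R J) N
       #>\<^bsub>free_Abelian_group (carrier (quotient_module R J) \<times> carrier N)\<^esub> frag_of (J +> \<one>, n)
    = tensor_kernel R (quotient_module R J) N
       #>\<^bsub>free_Abelian_group (carrier (quotient_module R J) \<times> carrier N)\<^esub> frag_of (J +> \<one>, m)"
proof -
  let ?Q = "quotient_module R J" and ?e = "J +> \<one>"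
  note Q = module_quotient_module[OF is_cring]
  note K = subgroup_tensor_kernel[OF Q N]
  have e: "?e \<in> carrier ?Q" by (auto simp: quotient_module_simps)
  have "n \<ominus>\<^bsub>N\<^esub> m \<in> carrier N" using nm by (simp add: fixed_part_def)
  then have "frag_of (?e, n \<ominus>\<^bsub>N\<^esub> m) \<in> tensor_kernel R ?Q N"
    using one_tensor_in_kernel_iff[OF N] nm by blast
  then have "frag_of (?e, n) - frag_of (?e, m) \<in> tensor_kernel R ?Q N"
    using subgroup_free_Abelian_add[OF K tensor_kernel_diff_right[OF Q N e assms(2,3)]]
    by fastforce
  then show ?thesis
    using free_Abelian_coset_eq_iff[OF K, of "frag_of (?e, n)" "frag_of (?e, m)"] e assms by simp
qed

text \<open>Image and kernel are both shown to be the set of classes of 1 (x) n with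
  \<open>g n\<close> in JN3.\<close>

lemma flat_quotient_module:
  "flat_module TYPE('x) TYPE('y) TYPE('z) R (quotient_module R J)"
proof -
  let ?Q = "quotient_module R J" and ?e = "J +> \<one>"
  note Q = module_quotient_module[OF is_cring]
  have e: "?e \<in> carrier ?Q" by (auto simp: quotient_module_simps)
  have exactness: "tensor_map R ?Q N1 N2 f ` carrier (tensor_product R ?Q N1) =
      kernel (tensor_product R ?Q N2) (tensor_product R ?Q N3) (tensor_map R ?Q N2 N3 g)"
    if N1: "Module.module R N1" and N2: "Module.module R N2" and N3: "Module.module R N3"
      and f: "f \<in> module_hom R N1 N2" and g: "g \<in> module_hom R N2 N3"
      and exact: "f ` carrier N1 = a_kernel N2 N3 g"
    for N1 :: "('a, 'x) module" and N2 :: "('a, 'y) module" and N3 :: "('a, 'z) module" and f g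
  proof -
    interpret N1: Module.module R N1 by fact
    interpret N2: Module.module R N2 by fact
    interpret N3: Module.module R N3 by fact
    let ?F = "\<lambda>N. free_Abelian_group (carrier ?Q \<times> carrier N)"
    let ?K1 = "tensor_kernel R ?Q N1" and ?K2 = "tensor_kernel R ?Q N2" and ?K3 = "tensor_kernel R ?Q N3"
    let ?c1 = "\<lambda>n. ?K1 #>\<^bsub>?F N1\<^esub> frag_of (?e, n)"
    let ?c2 = "\<lambda>n. ?K2 #>\<^bsub>?F N2\<^esub> frag_of (?e, n)"
    let ?c3 = "\<lambda>n. ?K3 #>\<^bsub>?F N3\<^esub> frag_of (?e, n)"
    have fc: "f n \<in> carrier N2" if "n \<in> carrier N1" for n
      using f that by (auto simp: module_hom_def hom_def)
    have gc: "g n \<in> carrier N3" if "n \<in> carrier N2" for n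
      using g that by (auto simp: module_hom_def hom_def)
    have "tensor_map R ?Q N1 N2 f ` carrier (tensor_product R ?Q N1)
        = (\<lambda>n. ?c2 (f n)) ` carrier N1"
      unfolding carrier_tensor_product_quotient[OF N1] image_image
      by (rule image_cong) (simp_all add: tensor_map_coset[OF Q N1 N2 f] e)
    also have "\<dots> = {?c2 n |n. n \<in> carrier N2 \<and> g n \<in> fixed_part R J N3}"
    proof (intro equalityI subsetI)
      fix X assume "X \<in> (\<lambda>n. ?c2 (f n)) ` carrier N1"
      then obtain n where n: "n \<in> carrier N1" "X = ?c2 (f n)" by blast
      then have "g (f n) = \<zero>\<^bsub>N3\<^esub>" using exact by (auto simp: a_kernel_def')
      moreover have "\<zero>\<^bsub>N3\<^esub> \<in> fixed_part R J N3"
        using subgroup.one_closed[OF subgroup_fixed_part[OF N3]] by simp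
      ultimately show "X \<in> {?c2 n |n. n \<in> carrier N2 \<and> g n \<in> fixed_part R J N3}"
        using n fc by force
    next
      fix X assume "X \<in> {?c2 n |n. n \<in> carrier N2 \<and> g n \<in> fixed_part R J N3}"
      then obtain n b where n: "n \<in> carrier N2" "X = ?c2 n" and b: "b \<in> J" "b \<odot>\<^bsub>N3\<^esub> g n = g n"
        by (auto simp: fixed_part_def)
      have bR: "b \<in> carrier R" using b Icarr by blast
      \<comment> \<open>Since \<open>b\<close> fixes \<open>g n\<close>, subtracting
        \<open>b n\<close> from \<open>n\<close> gives an element killed by \<open>g\<close>.
        Exactness makes it some \<open>f k\<close>, and \<open>n - f k = b n\<close> lies in JN2, so
        \<open>n\<close> and \<open>f k\<close> give the same tensor.\<close>
      let ?m = "n \<ominus>\<^bsub>N2\<^esub> b \<odot>\<^bsub>N2\<^esub> n"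
      interpret gh: abelian_group_hom N2 N3 g
        using g N2.M.abelian_group_axioms N3.M.abelian_group_axioms
        by (intro abelian_group_homI)
           (auto simp: module_hom_def group_hom_def group_hom_axioms_def N2.M.a_group N3.M.a_group)
      have "g (b \<odot>\<^bsub>N2\<^esub> n) = g n" using g b bR n by (auto simp: module_hom_def)
      then have "g ?m = \<zero>\<^bsub>N3\<^esub>"
        using n bR gc by (simp add: a_minus_def N3.M.r_neg)
      then have "?m \<in> a_kernel N2 N3 g"
        unfolding a_kernel_def' using N2.M.minus_closed N2.smult_closed n bR by blast
      then obtain k where k: "k \<in> carrier N1" "f k = ?m" unfolding exact[symmetric] by auto
      have "b \<odot>\<^bsub>N2\<^esub> n = n \<ominus>\<^bsub>N2\<^esub> f k"
        using n bR k N2.M.minus_minus by (simp add: a_minus_def N2.M.minus_add N2.M.a_assoc[symmetric] N2.M.r_neg)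
      then have "n \<ominus>\<^bsub>N2\<^esub> f k \<in> fixed_part R J N2"
        using smult_fixed_part[OF N2 b(1) n(1)] by simp
      then have "?c2 n = ?c2 (f k)" using one_tensor_coset_eq[OF N2 n(1) fc[OF k(1)]] by simp
      then show "X \<in> (\<lambda>n. ?c2 (f n)) ` carrier N1" using n k by blast
    qed
    also have "\<dots> = {?c2 n |n. n \<in> carrier N2 \<and> tensor_map R ?Q N2 N3 g (?c2 n) = ?K3}"
    proof -
      have "tensor_map R ?Q N2 N3 g (?c2 n) = ?K3 \<longleftrightarrow> g n \<in> fixed_part R J N3"
        if n: "n \<in> carrier N2" for n
      proof -
        note K3 = subgroup_tensor_kernel[OF Q N3]
        \<comment> \<open>The zero of the tensor product is the kernel itself, here written as the
          coset of 0 so that coset equality applies.\<close>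
        have "?K3 = ?K3 #>\<^bsub>?F N3\<^esub> 0"
          by (auto simp: r_coset_def)
        moreover have "tensor_map R ?Q N2 N3 g (?c2 n) = ?c3 (g n)"
          using n e by (simp add: tensor_map_coset[OF Q N2 N3 g])
        ultimately show ?thesis
          using free_Abelian_coset_eq_iff[OF K3, of "frag_of (?e, g n)" 0]
            one_tensor_in_kernel_iff[OF N3 gc[OF n]] e gc[OF n] by simp
      qed
      then show ?thesis by blast
    qed
    also have "\<dots> = kernel (tensor_product R ?Q N2) (tensor_product R ?Q N3) (tensor_map R ?Q N2 N3 g)"
      unfolding kernel_def carrier_tensor_product_quotient[OF N2]
      by (auto simp: tensor_product_def)
    finally show ?thesis .
  qed
  show ?thesis
    unfolding flat_module_def by (intro conjI allI impI Q, elim conjE, rule exactness)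
qed

end

section \<open>Torsion with respect to \<open>1 + I\<close>\<close>

text \<open>Fractions are sets of pairs, so r/1 = 0/1 is an equality of sets. It is tested on a
  single pair in one direction and proved memberwise in the other.\<close>

lemma (in cring) localization_kernel:
  assumes S: "S \<subseteq> carrier R" "\<one> \<in> S" and mult: "\<And>a b. \<lbrakk>a \<in> S; b \<in> S\<rbrakk> \<Longrightarrow> a \<otimes> b \<in> S"
  shows "a_kernel R (localization R S) (localization_map R S)
    = {r \<in> carrier R. \<exists>s\<in>S. s \<otimes> r = \<zero>}"
proof -
  have "fraction R S r \<one> = fraction R S \<zero> \<one> \<longleftrightarrow> (\<exists>s\<in>S. s \<otimes> r = \<zero>)" if r: "r \<in> carrier R" for r
  proof
    assume eq: "fraction R S r \<one> = fraction R S \<zero> \<one>"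
    \<comment> \<open>This pair lies in its own class; its membership in the class of 0/1 provides
      an element of \<open>S\<close> that kills \<open>r\<close>.\<close>
    have "(r, \<one>) \<in> fraction R S r \<one>"
      using r S by (auto simp: fraction_def)
    then have "(r, \<one>) \<in> fraction R S \<zero> \<one>" unfolding eq .
    then obtain t where t: "t \<in> S" "t \<otimes> (\<zero> \<otimes> \<one>) = t \<otimes> (r \<otimes> \<one>)"
      unfolding fraction_def by blast
    then have "t \<in> carrier R" using S by blast
    then have "t \<otimes> r = \<zero>" using t(2) r by simp
    then show "\<exists>s\<in>S. s \<otimes> r = \<zero>" using t(1) by blast
  next
    assume "\<exists>s\<in>S. s \<otimes> r = \<zero>"
    then obtain s where s: "s \<in> S" "s \<otimes> r = \<zero>" by blast
    have sR: "s \<in> carrier R" using S s by blast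
    \<comment> \<open>A witness \<open>t\<close> for one side gives the witness \<open>s t\<close>
      for the other, because \<open>s t\<close> kills \<open>r s'\<close>.\<close>
    have "(\<exists>t\<in>S. t \<otimes> (r \<otimes> s') = t \<otimes> (r' \<otimes> \<one>)) \<longleftrightarrow> (\<exists>t\<in>S. t \<otimes> (\<zero> \<otimes> s') = t \<otimes> (r' \<otimes> \<one>))"
      if r': "r' \<in> carrier R" "s' \<in> S" for r' s'
    proof -
      have s': "s' \<in> carrier R" using r' S by blast
      have rs: "s \<otimes> t \<otimes> (r \<otimes> s') = \<zero>" if "t \<in> carrier R" for t
      proof -
        have "s \<otimes> t \<otimes> (r \<otimes> s') = s \<otimes> r \<otimes> (t \<otimes> s')" using that r sR s' by algebra
        then show ?thesis using s(2) that s' by simp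
      qed
      show ?thesis
      proof
        assume "\<exists>t\<in>S. t \<otimes> (r \<otimes> s') = t \<otimes> (r' \<otimes> \<one>)"
        then obtain t where t: "t \<in> S" "t \<otimes> (r \<otimes> s') = t \<otimes> (r' \<otimes> \<one>)" by blast
        have tR: "t \<in> carrier R" using t S by blast
        have "s \<otimes> t \<otimes> (r' \<otimes> \<one>) = s \<otimes> t \<otimes> (r \<otimes> s')"
          using t(2) tR sR r s' r' by (simp add: m_assoc)
        then show "\<exists>t\<in>S. t \<otimes> (\<zero> \<otimes> s') = t \<otimes> (r' \<otimes> \<one>)"
          using rs[OF tR] mult[OF s(1) t(1)] s' sR tR by (intro bexI[of _ "s \<otimes> t"]) auto
      next
        assume "\<exists>t\<in>S. t \<otimes> (\<zero> \<otimes> s') = t \<otimes> (r' \<otimes> \<one>)"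
        then obtain t where t: "t \<in> S" "t \<otimes> (\<zero> \<otimes> s') = t \<otimes> (r' \<otimes> \<one>)" by blast
        have tR: "t \<in> carrier R" using t S by blast
        have "t \<otimes> r' = \<zero>" using t(2) tR s' r' by simp
        then have "s \<otimes> t \<otimes> (r' \<otimes> \<one>) = \<zero>" using tR sR r' by (simp add: m_assoc)
        then show "\<exists>t\<in>S. t \<otimes> (r \<otimes> s') = t \<otimes> (r' \<otimes> \<one>)"
          using rs[OF tR] mult[OF s(1) t(1)] by (intro bexI[of _ "s \<otimes> t"]) auto
      qed
    qed
    then show "fraction R S r \<one> = fraction R S \<zero> \<one>"
      unfolding fraction_def by blast
  qed
  then show ?thesis
    by (auto simp: a_kernel_def' localization_map_def localization_def)
qed

lemma (in cring) ideal_torsion: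
  assumes S: "S \<subseteq> carrier R" "\<one> \<in> S" and mult: "\<And>a b. \<lbrakk>a \<in> S; b \<in> S\<rbrakk> \<Longrightarrow> a \<otimes> b \<in> S"
  shows "ideal {r \<in> carrier R. \<exists>s\<in>S. s \<otimes> r = \<zero>} R" (is "ideal ?J R")
proof (rule idealI[OF ring_axioms])
  have SR: "s \<in> carrier R" if "s \<in> S" for s using that S by blast
  have left: "x \<otimes> a \<in> ?J" if a: "a \<in> ?J" and x: "x \<in> carrier R" for a x
  proof -
    obtain s where s: "s \<in> S" "a \<in> carrier R" "s \<otimes> a = \<zero>" using a by blast
    have "s \<otimes> (x \<otimes> a) = x \<otimes> (s \<otimes> a)" using m_lcomm[of s x a] s SR x by simp
    then have "s \<otimes> (x \<otimes> a) = \<zero>" using s x by simp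
    then show ?thesis using s x by blast
  qed
  then show "x \<otimes> a \<in> ?J" "a \<otimes> x \<in> ?J" if "a \<in> ?J" "x \<in> carrier R" for a x
    using that left[OF that] m_comm[of a x] by auto
  show "subgroup ?J (add_monoid R)"
  proof (rule add.subgroupI)
    have "\<one> \<otimes> \<zero> = \<zero>" by simp
    then have "\<zero> \<in> ?J" using S(2) zero_closed by blast
    then show "?J \<noteq> {}" by blast
    show "\<ominus> a \<in> ?J" if "a \<in> ?J" for a
      using that SR by (auto simp: r_minus)
    show "a \<oplus> b \<in> ?J" if ab: "a \<in> ?J" "b \<in> ?J" for a b
    proof -
      obtain s t where s: "s \<in> S" "a \<in> carrier R" "s \<otimes> a = \<zero>"
        and t: "t \<in> S" "b \<in> carrier R" "t \<otimes> b = \<zero>" using ab by blast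
      have "s \<otimes> t \<otimes> (a \<oplus> b) = t \<otimes> (s \<otimes> a) \<oplus> s \<otimes> (t \<otimes> b)"
        using s(2) t(2) SR[OF s(1)] SR[OF t(1)] by algebra
      then have "s \<otimes> t \<otimes> (a \<oplus> b) = \<zero>" using s t SR by simp
      then show ?thesis using s t mult by blast
    qed
  qed auto
qed

section \<open>The set 1 + I and the primes above its torsion\<close>

context ideal
begin

lemma one_plus_multiplicative:
  assumes "cring R" and S_def: "S = {\<one> \<oplus> x |x. x \<in> I}"
  shows "S \<subseteq> carrier R" "\<one> \<in> S" "\<And>a b. \<lbrakk>a \<in> S; b \<in> S\<rbrakk> \<Longrightarrow> a \<otimes> b \<in> S"
proof -
  interpret cring R by fact
  note I = additive_subgroup_axioms
  show "S \<subseteq> carrier R" using Icarr by (auto simp: S_def)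
  have "\<one> = \<one> \<oplus> \<zero>" by simp
  then show "\<one> \<in> S" unfolding S_def using additive_subgroup.zero_closed[OF I] by blast
  fix a b assume "a \<in> S" "b \<in> S"
  then obtain x y where xy: "x \<in> I" "y \<in> I" "a = \<one> \<oplus> x" "b = \<one> \<oplus> y" by (auto simp: S_def)
  have R: "x \<in> carrier R" "y \<in> carrier R" using xy Icarr by auto
  have "x \<oplus> y \<oplus> x \<otimes> y \<in> I"
    using additive_subgroup.a_closed[OF I] I_r_closed xy R by metis
  moreover have "a \<otimes> b = \<one> \<oplus> (x \<oplus> y \<oplus> x \<otimes> y)" unfolding xy(3,4) using R by algebra
  ultimately show "a \<otimes> b \<in> S" unfolding S_def by blast
qed

text \<open>For a prime \<open>p\<close> containing \<open>J\<close>, the multiplicative set \<open>S (R - p)\<close> does not contain 0.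
  A prime \<open>q\<close> disjoint from it lies below \<open>p\<close> and is not comaximal with \<open>I\<close>, so it also lies below a
  point of \<open>V(I)\<close>; stability then puts \<open>q\<close>, and hence \<open>p\<close>, into \<open>V(I)\<close>.\<close>

lemma vanishing_torsion:
  assumes "cring R" and stable: "generalization_stable R (vanishing R I)"
    and S_def: "S = {\<one> \<oplus> x |x. x \<in> I}" and J_def: "J = {r \<in> carrier R. \<exists>s\<in>S. s \<otimes> r = \<zero>}"
  shows "vanishing R J = vanishing R I"
proof
  interpret cring R by fact
  note S = one_plus_multiplicative[OF assms(1) S_def]
  \<comment> \<open>If (1 + x) r = 0 then r = -x r, a multiple of \<open>x\<close>.\<close>
  have "J \<subseteq> I"
  proof
    fix r assume "r \<in> J"
    then obtain x where x: "x \<in> I" "r \<in> carrier R" "(\<one> \<oplus> x) \<otimes> r = \<zero>" by (auto simp: J_def S_def)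
    have xR: "x \<in> carrier R" using x Icarr by blast
    have "r = (\<one> \<oplus> x) \<otimes> r \<ominus> x \<otimes> r" using x(2) xR by algebra
    also have "\<dots> = \<ominus> (x \<otimes> r)" using x xR by (simp add: a_minus_def)
    finally have "r = \<ominus> (x \<otimes> r)" .
    moreover have "\<ominus> (x \<otimes> r) \<in> I"
      using additive_subgroup.a_inv_closed[OF additive_subgroup_axioms I_r_closed[OF x(1,2)]] .
    ultimately show "r \<in> I" by simp
  qed
  then show "vanishing R I \<subseteq> vanishing R J" by (auto simp: vanishing_def)
  show "vanishing R J \<subseteq> vanishing R I"
  proof
    fix p assume "p \<in> vanishing R J"
    then have p: "p \<in> Spec R" "J \<subseteq> p" by (auto simp: vanishing_def)
    interpret p: primeideal p R by (rule Spec_primeideal[OF p(1)])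
    let ?T = "{s \<otimes> t |s t. s \<in> S \<and> t \<in> carrier R - p}"
    have one: "\<one> \<in> carrier R - p" using one_notin_Spec[OF p(1)] by simp
    have T1: "?T \<subseteq> carrier R" using S(1) by auto
    have "\<one> \<otimes> \<one> \<in> ?T" using S(2) one by blast
    then have T2: "\<one> \<in> ?T" by simp
    have T3: "a \<otimes> b \<in> ?T" if ab: "a \<in> ?T" "b \<in> ?T" for a b
    proof -
      obtain s t where a: "a = s \<otimes> t" "s \<in> S" "t \<in> carrier R - p" using ab(1) by blast
      obtain s' t' where b: "b = s' \<otimes> t'" "s' \<in> S" "t' \<in> carrier R - p" using ab(2) by blast
      have R: "s \<in> carrier R" "s' \<in> carrier R" "t \<in> carrier R" "t' \<in> carrier R"
        using S(1) a b by auto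
      have "a \<otimes> b = (s \<otimes> s') \<otimes> (t \<otimes> t')" unfolding a b using R by algebra
      moreover have "s \<otimes> s' \<in> S" using S(3) a b by blast
      moreover have "t \<otimes> t' \<in> carrier R - p" using p.I_prime[OF R(3,4)] a(3) b(3) R by auto
      ultimately show ?thesis by blast
    qed
    \<comment> \<open>A relation s t = 0 would put \<open>t\<close> into \<open>J\<close> and hence
      into \<open>p\<close>.\<close>
    have "\<zero> \<notin> ?T"
    proof
      assume "\<zero> \<in> ?T"
      then obtain s t where "\<zero> = s \<otimes> t" "s \<in> S" "t \<in> carrier R - p" by blast
      then have "t \<in> J" "t \<notin> p" unfolding J_def by auto
      then show False using p(2) by blast
    qed
    then have disj: "{\<zero>} \<inter> ?T = {}" by blast
    obtain q where q: "q \<in> Spec R" "q \<inter> ?T = {}"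
      using exists_prime_disjoint[OF zeroideal T1 T2 T3 disj] by blast
    have qR: "q \<subseteq> carrier R" by (rule additive_subgroup.a_subset[OF Spec_additive_subgroup[OF q(1)]])
    have "q \<subseteq> p"
    proof
      fix t assume t: "t \<in> q"
      show "t \<in> p"
      proof (rule ccontr)
        assume "t \<notin> p"
        then have "\<one> \<otimes> t \<in> ?T" using S(2) t qR by blast
        then show False using q(2) t qR by (auto simp: subset_iff)
      qed
    qed
    have qS: "s \<notin> q" if "s \<in> S" for s
    proof -
      have "s \<otimes> \<one> \<in> ?T" using that one by blast
      moreover have "s \<otimes> \<one> = s" using that S(1) by auto
      ultimately show ?thesis using q(2) by auto
    qed
    \<comment> \<open>Otherwise x = 1 + (-y) would be an element of \<open>S\<close> in
      \<open>q\<close>.\<close>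
    have "x \<oplus> y \<noteq> \<one>" if xy: "x \<in> q" "y \<in> I" for x y
    proof
      assume eq: "x \<oplus> y = \<one>"
      have R: "x \<in> carrier R" "y \<in> carrier R" using xy qR Icarr by auto
      have "x = \<one> \<oplus> \<ominus> y" unfolding eq[symmetric] using R by algebra
      moreover have "\<ominus> y \<in> I" using additive_subgroup.a_inv_closed[OF additive_subgroup_axioms xy(2)] .
      ultimately have "x \<in> S" unfolding S_def by blast
      then show False using qS xy by blast
    qed
    then obtain m where m: "m \<in> Spec R" "q \<subseteq> m" "I \<subseteq> m"
      using exists_prime_above_both[OF Spec_ideal[OF q(1)] ideal_axioms] by blast
    \<comment> \<open>Stability is stated for strict inclusions, so equality of \<open>q\<close> and
      \<open>m\<close> is a separate case.\<close>
    have "q \<in> vanishing R I"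
    proof (cases "q = m")
      case True
      then show ?thesis using m by (simp add: vanishing_def)
    next
      case False
      then have "q \<subset> m" "m \<in> vanishing R I" using m by (auto simp: vanishing_def)
      then show ?thesis using stable q(1) m(1) unfolding generalization_stable_def by blast
    qed
    then show "p \<in> vanishing R I" using p(1) \<open>q \<subseteq> p\<close> by (auto simp: vanishing_def)
  qed
qed

end

text \<open>If no power of \<open>x\<close> were in \<open>J\<close>, some prime above
  \<open>J\<close> would avoid all of them, although \<open>x\<close> lies in every such
  prime.\<close>

lemma (in cring) power_mem_ideal:
  assumes J: "ideal J R" and x: "x \<in> carrier R"
    and "\<And>p. \<lbrakk>p \<in> Spec R; J \<subseteq> p\<rbrakk> \<Longrightarrow> x \<in> p"
  obtains n :: nat where "x [^] n \<in> J"
proof -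
  let ?S = "{x [^] n |n::nat. True}"
  have S1: "?S \<subseteq> carrier R" using x by auto
  have "x [^] (0::nat) \<in> ?S" by blast
  then have S2: "\<one> \<in> ?S" by simp
  have S3: "a \<otimes> b \<in> ?S" if ab: "a \<in> ?S" "b \<in> ?S" for a b
  proof -
    obtain n m :: nat where "a = x [^] n" "b = x [^] m" using ab by blast
    then have "a \<otimes> b = x [^] (n + m)" using x by (simp add: nat_pow_mult)
    then show ?thesis by blast
  qed
  have "J \<inter> ?S \<noteq> {}"
  proof
    assume disj: "J \<inter> ?S = {}"
    obtain p where p: "p \<in> Spec R" "J \<subseteq> p" "p \<inter> ?S = {}"
      using exists_prime_disjoint[OF J S1 S2 S3 disj] by blast
    have "x [^] (1::nat) \<in> ?S" by blast
    then have "x \<in> ?S" using x by simp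
    then show False using assms(3)[OF p(1,2)] p(3) by blast
  qed
  then show thesis using that by blast
qed

lemma (in ideal) torsion_pure:
  assumes "cring R" and stable: "generalization_stable R (vanishing R I)"
    and S_def: "S = {\<one> \<oplus> x |x. x \<in> I}" and J_def: "J = {r \<in> carrier R. \<exists>s\<in>S. s \<otimes> r = \<zero>}"
    and a: "a \<in> J"
  shows "\<exists>b\<in>J. b \<otimes> a = a"
proof -
  interpret cring R by fact
  note S = one_plus_multiplicative[OF assms(1) S_def]
  have J: "ideal J R" unfolding J_def by (rule ideal_torsion[OF S])
  obtain x where x: "x \<in> I" "a \<in> carrier R" "(\<one> \<oplus> x) \<otimes> a = \<zero>" using a by (auto simp: J_def S_def)
  have xR: "x \<in> carrier R" using x Icarr by blast
  \<comment> \<open>The torsion equation says that -x fixes \<open>a\<close>; so do all its powers,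
    one of which will be the multiplier in \<open>J\<close>.\<close>
  have "\<ominus> x \<otimes> a = a \<ominus> (\<one> \<oplus> x) \<otimes> a" using x(2) xR by algebra
  then have fix1: "\<ominus> x \<otimes> a = a" using x by (simp add: a_minus_def)
  have fixn: "(\<ominus> x) [^] n \<otimes> a = a" for n :: nat
    using x xR fix1 by (induction n) (simp_all add: m_assoc)
  have "\<ominus> x \<in> p" if p: "p \<in> Spec R" "J \<subseteq> p" for p
  proof -
    have "p \<in> vanishing R I"
      using vanishing_torsion[OF assms(1) stable S_def J_def] p by (auto simp: vanishing_def)
    then have "x \<in> p" using x(1) by (auto simp: vanishing_def)
    then show ?thesis by (rule additive_subgroup.a_inv_closed[OF Spec_additive_subgroup[OF p(1)]])
  qed
  then obtain n :: nat where "(\<ominus> x) [^] n \<in> J"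
    using power_mem_ideal[OF J, of "\<ominus> x"] xR by blast
  then show ?thesis using fixn by blast
qed

theorem theorem3p1:
  fixes R :: "('a, 'b) ring_scheme" (structure)
    and E :: "'a set set"
  assumes "cring R"
    and "E \<subseteq> Spec R"
  shows
    "(closedin (zariski_topology R) E \<longrightarrow>
        closedin (flat_topology R) (generalization_closure R E)) \<and>
     (closedin (patch_topology R) E \<longrightarrow>
        closedin (zariski_topology R) (specialization_closure R E)) \<and>
     (\<forall>I. generalization_stable R E \<and> ideal I R \<and> E = vanishing R I \<longrightarrow>
        (let S = {\<one> \<oplus> x |x. x \<in> I};
             J = a_kernel R (localization R S) (localization_map R S)
         in flat_module TYPE('x) TYPE('y) TYPE('z) R (quotient_module R J) \<and>
            E = vanishing R J))"
proof (intro conjI impI allI)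
  interpret cring R by fact
  show "closedin (flat_topology R) (generalization_closure R E)"
    if "closedin (zariski_topology R) E"
    using closedin_flat_generalization_closure[OF that] .
  show "closedin (zariski_topology R) (specialization_closure R E)"
    if "closedin (patch_topology R) E"
    using closedin_zariski_specialization_closure[OF that] .
  fix I assume I: "generalization_stable R E \<and> ideal I R \<and> E = vanishing R I"
  then interpret I: ideal I R by blast
  define S where "S = {\<one> \<oplus> x |x. x \<in> I}"
  define J where "J = {r \<in> carrier R. \<exists>s\<in>S. s \<otimes> r = \<zero>}"
  have stable: "generalization_stable R (vanishing R I)" using I by blast
  note S = I.one_plus_multiplicative[OF assms(1) S_def]
  \<comment> \<open>The kernel is replaced by the explicit torsion ideal, to which the results on
    purity and on V(J) apply.\<close>
  have J: "a_kernel R (localization R S) (localization_map R S) = J"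
    unfolding J_def by (rule localization_kernel[OF S])
  have "ideal J R" unfolding J_def by (rule ideal_torsion[OF S])
  then interpret pure_ideal J R
    using I.torsion_pure[OF assms(1) stable S_def J_def] assms(1)
    by (intro pure_ideal.intro pure_ideal_axioms.intro)
  have "E = vanishing R J"
    using I.vanishing_torsion[OF assms(1) stable S_def J_def] I by simp
  then show "let S = {\<one> \<oplus> x |x. x \<in> I};
        J = a_kernel R (localization R S) (localization_map R S)
      in flat_module TYPE('x) TYPE('y) TYPE('z) R (quotient_module R J) \<and> E = vanishing R J"
    unfolding Let_def S_def[symmetric] J using flat_quotient_module by blast
qed

end
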